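(* Let $d\ge 3$ and let $\mu$ be an $\mathrm{ASL}_d(\mathbb Z)$-invariant Borel probability measure on $\{0,1\}^{\mathbb Z^d}$ such that the action of $\mathbb Z^d$ (by translations) on $(\{0,1\}^{\mathbb Z^d},\mu)$ is weakly mixing. Then $\mu$ is the distribution of a Bernoulli random subset, i.e. there is $p\in[0,1]$ such that $\mu=(p\delta_0+(1-p)\delta_1)^{\mathbb Z^d}$ (product measure).
   Context: $\mathrm{ASL}_d(\mathbb Z)=\mathrm{SL}_d(\mathbb Z)\ltimes\mathbb Z^d$ is the group of affine maps $t\mapsto\gamma_0t+v$ of $\mathbb Z^d$ with $\gamma_0\in \mathrm{SL}_d(\mathbb Z)$, $v\in\mathbb Z^d$; it acts on $\{0,1\}^{\mathbb Z^d}$, the space of subsets of $\mathbb Z^d$, through its action on $\mathbb Z^d$, and $\mathbb Z^d\subset \mathrm{ASL}_d(\mathbb Z)$ is the subgroup of translations. *)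

theory Defs
  imports "HOL-Probability.Probability"
begin

text \<open>Group actions on a measure space are given by a set \<open>G\<close> of group elements together with
  \<open>act :: 'g \<Rightarrow> 'x \<Rightarrow> 'x\<close>.\<close>

definition invariant_measure :: "'g set \<Rightarrow> ('g \<Rightarrow> 'x \<Rightarrow> 'x) \<Rightarrow> 'x measure \<Rightarrow> bool" where
  "invariant_measure G act M \<longleftrightarrow>
     (\<forall>g\<in>G. act g \<in> measurable M M \<and> distr M M (act g) = M)"

definition ergodic_action :: "'g set \<Rightarrow> ('g \<Rightarrow> 'x \<Rightarrow> 'x) \<Rightarrow> 'x measure \<Rightarrow> bool" where
  "ergodic_action G act M \<longleftrightarrow>
     (\<forall>A\<in>sets M. (\<forall>g\<in>G. act g -` A \<inter> space M = A) \<longrightarrow> measure M A = 0 \<or> measure M A = 1)"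

text \<open>Weak mixing of a probability measure preserving action: the diagonal action on the
  square is ergodic.\<close>

definition weakly_mixing_action :: "'g set \<Rightarrow> ('g \<Rightarrow> 'x \<Rightarrow> 'x) \<Rightarrow> 'x measure \<Rightarrow> bool" where
  "weakly_mixing_action G act M \<longleftrightarrow>
     ergodic_action G (\<lambda>g. map_prod (act g) (act g)) (M \<Otimes>\<^sub>M M)"

definition ASL :: "(int ^ 'd \<Rightarrow> int ^ 'd) set" where
  "ASL = {(\<lambda>t. A *v t + v) | A v. det A = 1}"

definition translation_group :: "(int ^ 'd \<Rightarrow> int ^ 'd) set" where
  "translation_group = {(\<lambda>t. t + v) | v. True}"

text \<open>A subset of \<open>\<int>\<^sup>d\<close> is represented by its indicator function \<open>\<omega>\<close>, with \<open>False\<close> for 0 and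
  \<open>True\<close> for 1. A bijection \<open>g\<close> sends the subset \<open>S\<close> to \<open>g ` S\<close>, whose indicator
  function is \<open>\<omega> \<circ> inv g\<close>.\<close>

definition subset_action :: "('a \<Rightarrow> 'a) \<Rightarrow> ('a \<Rightarrow> bool) \<Rightarrow> ('a \<Rightarrow> bool)" where
  "subset_action g \<omega> = \<omega> \<circ> inv g"

instance bool :: second_countable_topology
proof
  have "open = generate_topology (UNIV :: bool set set)"
    by (intro ext iffI generate_topology.Basis UNIV_I Topological_Spaces.open_discrete)
  then show "\<exists>B :: bool set set. countable B \<and> open = generate_topology B"
    by (intro exI[of _ UNIV]) auto
qed

text \<open>The Borel sigma-algebra of the product topology on \<open>{0,1}\<^sup>I\<close>, \<open>I\<close> countable, is the product
  sigma-algebra, so Borel measures can be compared with product measures.\<close>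

lemma sets_borel_fun_bool:
  "sets (borel :: ('i::countable \<Rightarrow> bool) measure) = sets (PiM UNIV (\<lambda>_. count_space UNIV))"
proof -
  have "sets (PiM (UNIV :: 'i set) (\<lambda>_. count_space UNIV :: bool measure))
      = sets (PiM (UNIV :: 'i set) (\<lambda>_. borel))"
    by (intro sets_PiM_cong) (auto simp: sets_borel_eq_count_space)
  then show ?thesis by (simp only: sets_PiM_equal_borel)
qed

end

theory Submission
  imports Defs
begin

text \<open>Let \<open>H\<close> be a coordinate hyperplane of translations. First, \<open>H\<close> acts ergodically, even on the
  square of the process. Take an \<open>H\<close>-invariant function of mean zero and a cylinder event, and apply
  shears that fix one level of the event's sites pointwise. The sheared invariant functions are
  invariant under pairwise different hyperplanes, and by weak mixing of \<open>\<int>\<^sup>d\<close> such functions are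
  independent. By induction on the number of levels the sheared products are therefore orthogonal to
  each other, while their correlation with the fixed level does not depend on the shear; so this
  correlation vanishes.

  Consequently \<open>H\<close> acts weakly mixingly. A second induction of the same kind, now with shears whose
  displacement lies in \<open>H\<close>, shows that the restrictions of the process to the different levels
  parallel to \<open>H\<close> are independent. Separating the sites of a finite set by successive coordinates
  gives independence of all sites.\<close>

section \<open>Bounded measurable functions\<close>

text \<open>Multiplying two sheared copies of a product removes one height but doubles the number of
  invariant functions. The first induction therefore treats a whole family \<open>G k\<close>, one
  function for each hyperplane \<open>v $ a = k * v $ b\<close>. A shear by \<open>j\<close> turns
  the slope \<open>k\<close> into \<open>k + j\<close>, so a generic \<open>j\<close> keeps the
  slopes of the two copies disjoint. The square of the process enters because the second induction
  needs mixing along the hyperplane, not just ergodicity: ergodicity of the square yields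
  translations at which finitely many correlations are small simultaneously. Such translations are
  collected in a filter, which can be restricted to a coset of finite index. That restriction is
  essential, since an integral shear moves a level only by multiples of its distance to the fixed
  level. Both inductions conclude by one Hilbert space fact: a bounded function cannot have the same
  nonzero inner product with arbitrarily many uniformly bounded, almost orthogonal
  functions.\<close>

definition bounded_measurable :: "'a measure \<Rightarrow> ('a \<Rightarrow> real) \<Rightarrow> bool" where
  "bounded_measurable M f \<longleftrightarrow> f \<in> borel_measurable M \<and> (\<exists>C. \<forall>x. \<bar>f x\<bar> \<le> C)"

lemma bounded_measurableI:
  "f \<in> borel_measurable M \<Longrightarrow> (\<And>x. \<bar>f x\<bar> \<le> C) \<Longrightarrow> bounded_measurable M f"
  unfolding bounded_measurable_def by blast

lemma bounded_measurable_measurable [measurable_dest]: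
  "bounded_measurable M f \<Longrightarrow> f \<in> borel_measurable M"
  unfolding bounded_measurable_def by blast

lemma bounded_measurable_const [intro]: "bounded_measurable M (\<lambda>_. c)"
  by (rule bounded_measurableI[where C = "\<bar>c\<bar>"]) auto

lemma bounded_measurable_indicator [intro]:
  "A \<in> sets M \<Longrightarrow> bounded_measurable M (indicator A)"
  by (rule bounded_measurableI[where C = 1]) (auto simp: indicator_def)

lemma bounded_measurable_add [intro]:
  assumes "bounded_measurable M f" "bounded_measurable M g"
  shows "bounded_measurable M (\<lambda>x. f x + g x)"
proof -
  obtain C D where "\<And>x. \<bar>f x\<bar> \<le> C" "\<And>x. \<bar>g x\<bar> \<le> D"
    using assms unfolding bounded_measurable_def by blast
  then have "\<bar>f x + g x\<bar> \<le> C + D" for x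
    by (meson abs_triangle_ineq add_mono order_trans)
  then show ?thesis
    using assms by (intro bounded_measurableI[where C = "C + D"]) auto
qed

lemma bounded_measurable_mult [intro]:
  assumes "bounded_measurable M f" "bounded_measurable M g"
  shows "bounded_measurable M (\<lambda>x. f x * g x)"
proof -
  obtain C D where "\<And>x. \<bar>f x\<bar> \<le> C" "\<And>x. \<bar>g x\<bar> \<le> D"
    using assms unfolding bounded_measurable_def by blast
  then have "\<bar>f x * g x\<bar> \<le> C * D" for x
    unfolding abs_mult by (meson abs_ge_zero mult_mono order_trans)
  then show ?thesis
    using assms by (intro bounded_measurableI[where C = "C * D"]) auto
qed

lemma bounded_measurable_diff [intro]:
  assumes "bounded_measurable M f" "bounded_measurable M g"
  shows "bounded_measurable M (\<lambda>x. f x - g x)"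
  using bounded_measurable_add[OF assms(1)
      bounded_measurable_mult[OF bounded_measurable_const[of M "- 1"] assms(2)]] by simp

lemma bounded_measurable_sum [intro]:
  "(\<And>i. i \<in> I \<Longrightarrow> bounded_measurable M (f i)) \<Longrightarrow> bounded_measurable M (\<lambda>x. \<Sum>i\<in>I. f i x)"
  by (induction I rule: infinite_finite_induct) (auto intro: bounded_measurable_const)

lemma bounded_measurable_prod [intro]:
  "(\<And>i. i \<in> I \<Longrightarrow> bounded_measurable M (f i)) \<Longrightarrow> bounded_measurable M (\<lambda>x. \<Prod>i\<in>I. f i x)"
  by (induction I rule: infinite_finite_induct) (auto intro: bounded_measurable_const)

lemma bounded_measurable_comp:
  assumes "bounded_measurable N f" "T \<in> measurable M N"
  shows "bounded_measurable M (\<lambda>x. f (T x))"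
  using assms unfolding bounded_measurable_def by auto

lemma (in finite_measure) integrable_bounded_measurable:
  assumes "bounded_measurable M f"
  shows "integrable M f"
proof -
  obtain C where "\<And>x. \<bar>f x\<bar> \<le> C"
    using assms unfolding bounded_measurable_def by blast
  then show ?thesis
    using assms by (intro integrable_const_bound[where B = C]) auto
qed

text \<open>Among approximately orthogonal vectors of bounded length only few can have a given nonzero
  inner product with \<open>g\<close>.\<close>

lemma (in prob_space) asymptotically_orthogonal:
  fixes g :: "'a \<Rightarrow> real" and h :: "'i \<Rightarrow> 'a \<Rightarrow> real"
  assumes g: "bounded_measurable M g"
    and h: "\<And>i. h i \<in> borel_measurable M" and hC: "\<And>i x. \<bar>h i x\<bar> \<le> C"
    and c: "\<And>i. i \<in> I \<Longrightarrow> expectation (\<lambda>x. g x * h i x) = c"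
    and orth: "\<And>J e. finite J \<Longrightarrow> J \<subseteq> I \<Longrightarrow> 0 < e \<Longrightarrow>
      \<exists>i\<in>I. \<forall>j\<in>J. \<bar>expectation (\<lambda>x. h j x * h i x)\<bar> \<le> e"
  shows "c = 0"
proof -
  have bh: "bounded_measurable M (h i)" for i
    using h hC by (rule bounded_measurableI)
  \<comment> \<open>Greedy selection: \<open>orth\<close>, applied to the indices already chosen,
    supplies the next one.\<close>
  have choice: "\<exists>s :: nat \<Rightarrow> 'i. (\<forall>p<n. s p \<in> I) \<and>
      (\<forall>q<n. \<forall>p<q. \<bar>expectation (\<lambda>x. h (s p) x * h (s q) x)\<bar> \<le> e)" if "0 < e" for n e
  proof (induction n)
    case 0
    then show ?case by auto
  next
    case (Suc n)
    then obtain s where s: "\<forall>p<n. s p \<in> I"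
      "\<forall>q<n. \<forall>p<q. \<bar>expectation (\<lambda>x. h (s p) x * h (s q) x)\<bar> \<le> e" by blast
    have "finite (s ` {..<n})" "s ` {..<n} \<subseteq> I" using s by auto
    from orth[OF this \<open>0 < e\<close>] obtain i where i: "i \<in> I"
      "\<And>p. p < n \<Longrightarrow> \<bar>expectation (\<lambda>x. h (s p) x * h i x)\<bar> \<le> e" by auto
    show ?case
      by (rule exI[of _ "s(n := i)"]) (use s i in \<open>auto simp: less_Suc_eq\<close>)
  qed
  \<comment> \<open>The maximum with 1 makes \<open>D\<close> positive, because
    \<open>D\<^sup>2\<close> becomes a denominator in \<open>t\<close>.\<close>
  obtain D where D: "\<And>x. \<bar>g x\<bar> \<le> D" "D > 0"
  proof -
    obtain D0 where "\<forall>x. \<bar>g x\<bar> \<le> D0"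
      using g unfolding bounded_measurable_def by blast
    then have "\<bar>g x\<bar> \<le> max D0 1" for x by (meson max.coboundedI1)
    then show ?thesis using that[of "max D0 1"] by auto
  qed
  have gg: "expectation (\<lambda>x. g x * g x) \<le> D\<^sup>2"
  proof -
    have "expectation (\<lambda>x. g x * g x) \<le> expectation (\<lambda>x. D\<^sup>2)"
    proof (intro integral_mono integrable_bounded_measurable)
      show "g x * g x \<le> D\<^sup>2" for x
        using power_mono[OF D(1)[of x], of 2] by (simp add: power2_eq_square)
    qed (use g in auto)
    then show ?thesis by (simp add: prob_space)
  qed
  have bound: "c\<^sup>2 \<le> D\<^sup>2 * (C\<^sup>2 / real n + e)" if "0 < e" "n \<ge> 1" for n :: nat and e
  proof -
    obtain s where s: "\<forall>p<n. s p \<in> I"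
      "\<forall>q<n. \<forall>p<q. \<bar>expectation (\<lambda>x. h (s p) x * h (s q) x)\<bar> \<le> e"
      using choice[OF \<open>0 < e\<close>, of n] by blast
    define W where "W = (\<lambda>x. \<Sum>p<n. h (s p) x)"
    have bW: "bounded_measurable M W" unfolding W_def using bh by auto
    have pq: "expectation (\<lambda>x. h (s p) x * h (s q) x) \<le> (if p = q then C\<^sup>2 else 0) + e"
      if "p < n" "q < n" for p q
    proof (cases p q rule: linorder_cases)
      case equal
      have "expectation (\<lambda>x. h (s q) x * h (s q) x) \<le> expectation (\<lambda>x. C\<^sup>2)"
      proof (intro integral_mono integrable_bounded_measurable)
        show "h (s q) x * h (s q) x \<le> C\<^sup>2" for x
          using power_mono[OF hC[of "s q" x], of 2] by (simp add: power2_eq_square)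
      qed (use bh in auto)
      then show ?thesis using equal \<open>0 < e\<close> by (simp add: prob_space)
    next
      case less
      then show ?thesis using s(2) that abs_ge_self order_trans by fastforce
    next
      case greater
      then show ?thesis using s(2) that abs_ge_self order_trans
        by (fastforce simp: mult.commute)
    qed
    have WW: "expectation (\<lambda>x. W x * W x) \<le> n * C\<^sup>2 + n * n * e"
    proof -
      have "expectation (\<lambda>x. W x * W x)
          = (\<Sum>p<n. \<Sum>q<n. expectation (\<lambda>x. h (s p) x * h (s q) x))"
        unfolding W_def sum_product
        by (subst Bochner_Integration.integral_sum
            | intro integrable_bounded_measurable bounded_measurable_sum bounded_measurable_mult bh
            | rule sum.cong refl)+
      also have "\<dots> \<le> (\<Sum>p<n. \<Sum>q<n. (if p = q then C\<^sup>2 else 0) + e)"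
        by (intro sum_mono pq) auto
      also have "\<dots> = n * C\<^sup>2 + n * n * e"
        by (simp add: sum.distrib algebra_simps)
      finally show ?thesis .
    qed
    have gW: "expectation (\<lambda>x. g x * W x) = n * c"
    proof -
      have "expectation (\<lambda>x. g x * W x) = (\<Sum>p<n. expectation (\<lambda>x. g x * h (s p) x))"
        unfolding W_def sum_distrib_left
        by (subst Bochner_Integration.integral_sum)
          (auto intro!: integrable_bounded_measurable bounded_measurable_mult g bh)
      then show ?thesis using c s(1) by simp
    qed
    \<comment> \<open>The minimizer of the quadratic bound for the squared distance from
      \<open>W\<close> to \<open>t * g\<close>, where the squared norm of \<open>g\<close> is
      replaced by its bound \<open>D\<^sup>2\<close>. Its nonnegativity is a Bessel type
      inequality.\<close>
    define t where "t = n * c / D\<^sup>2"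
    have "0 \<le> expectation (\<lambda>x. (W x - t * g x)\<^sup>2)" by simp
    also have "\<dots> = expectation (\<lambda>x. W x * W x - 2 * t * (g x * W x) + t\<^sup>2 * (g x * g x))"
      by (intro Bochner_Integration.integral_cong) (auto simp: power2_eq_square algebra_simps)
    also have "\<dots> = expectation (\<lambda>x. W x * W x) - 2 * t * expectation (\<lambda>x. g x * W x)
        + t\<^sup>2 * expectation (\<lambda>x. g x * g x)"
    proof -
      have i: "integrable M (\<lambda>x. W x * W x)" "integrable M (\<lambda>x. g x * W x)"
        "integrable M (\<lambda>x. g x * g x)"
        by (auto intro!: integrable_bounded_measurable bW g)
      then show ?thesis by simp
    qed
    also have "\<dots> \<le> (n * C\<^sup>2 + n * n * e) - 2 * t * (n * c) + t\<^sup>2 * D\<^sup>2"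
      using WW gW mult_left_mono[OF gg, of "t\<^sup>2"] by simp
    also have "\<dots> = (n * C\<^sup>2 + n * n * e) - n * n * c\<^sup>2 / D\<^sup>2"
      using D(2) by (simp add: t_def power2_eq_square field_simps)
    also have "\<dots> = real n * real n * (C\<^sup>2 / n + e - c\<^sup>2 / D\<^sup>2)"
      using that by (simp add: field_simps)
    finally have "0 \<le> real n * real n * (C\<^sup>2 / n + e - c\<^sup>2 / D\<^sup>2)" .
    moreover have "0 < real n * real n" using that by simp
    ultimately have "0 \<le> C\<^sup>2 / n + e - c\<^sup>2 / D\<^sup>2"
      by (simp add: zero_le_mult_iff not_le)
    then show ?thesis using D(2) by (simp add: field_simps)
  qed
  \<comment> \<open>Here \<open>bound\<close> is taken with \<open>e = 1 / n\<close>, so that both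
    error terms vanish together.\<close>
  have "(\<lambda>n. D\<^sup>2 * (C\<^sup>2 / real n + 1 / real n)) \<longlonglongrightarrow> D\<^sup>2 * (0 + 0)"
    by (intro tendsto_intros lim_const_over_n)
  then have "c\<^sup>2 \<le> D\<^sup>2 * (0 + 0)"
    by (rule tendsto_lowerbound) (auto intro!: bound eventually_sequentiallyI[of 1])
  then show ?thesis by simp
qed

section \<open>Ergodicity and correlations\<close>

text \<open>The increments are at most \<open>(1/2) ^ n\<close> in L1, so the sum of their absolute
  values has finite expectation and is finite almost everywhere.\<close>

lemma (in prob_space) AE_convergent_of_L2_summable:
  fixes f :: "nat \<Rightarrow> 'a \<Rightarrow> real"
  assumes f: "\<And>n. bounded_measurable M (f n)"
    and le: "\<And>n. expectation (\<lambda>x. (f (Suc n) x - f n x)\<^sup>2) \<le> (1/4) ^ n"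
  shows "AE x in M. convergent (\<lambda>n. f n x)"
proof -
  define d where "d n x = f (Suc n) x - f n x" for n x
  have bd: "bounded_measurable M (d n)" for n
    unfolding d_def using f by auto
  have babs: "bounded_measurable M (\<lambda>x. \<bar>d n x\<bar>)" for n
    using bd[of n] unfolding bounded_measurable_def by auto
  have L1: "expectation (\<lambda>x. \<bar>d n x\<bar>) \<le> (1/2) ^ n" for n
  proof -
    define a where "a = (1/2 :: real) ^ n"
    have a: "a > 0" "(1/4) ^ n = a * a" unfolding a_def by (auto simp: power_mult_distrib[symmetric])
    have sq: "bounded_measurable M (\<lambda>x. (d n x)\<^sup>2)"
      unfolding power2_eq_square using bd by auto
    \<comment> \<open>The inequality of arithmetic and geometric means with weight \<open>a\<close>
      replaces Cauchy-Schwarz; \<open>a = (1/2) ^ n\<close> balances the two terms.\<close>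
    have "expectation (\<lambda>x. \<bar>d n x\<bar>) \<le> expectation (\<lambda>x. a / 2 + (d n x)\<^sup>2 * (1 / (2 * a)))"
    proof (intro integral_mono integrable_bounded_measurable babs bounded_measurable_add
        bounded_measurable_mult sq bounded_measurable_const)
      fix x
      have "0 \<le> (\<bar>d n x\<bar> - a)\<^sup>2" by simp
      then have "2 * a * \<bar>d n x\<bar> \<le> a\<^sup>2 + (d n x)\<^sup>2"
        by (simp add: power2_eq_square algebra_simps)
      then show "\<bar>d n x\<bar> \<le> a / 2 + (d n x)\<^sup>2 * (1 / (2 * a))"
        using a by (simp add: field_simps power2_eq_square)
    qed
    also have "\<dots> = a / 2 + expectation (\<lambda>x. (d n x)\<^sup>2) * (1 / (2 * a))"
      using integrable_bounded_measurable[OF sq] by (simp add: prob_space)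
    also have "\<dots> \<le> a / 2 + (a * a) * (1 / (2 * a))"
      using le[of n] a by (intro add_mono mult_right_mono) (auto simp: d_def)
    also have "\<dots> = a" using a by simp
    finally show ?thesis by (simp add: a_def)
  qed
  have "(\<integral>\<^sup>+x. (\<Sum>n. ennreal \<bar>d n x\<bar>) \<partial>M) = (\<Sum>n. \<integral>\<^sup>+x. ennreal \<bar>d n x\<bar> \<partial>M)"
    using bd by (intro nn_integral_suminf) auto
  also have "\<dots> = (\<Sum>n. ennreal (expectation (\<lambda>x. \<bar>d n x\<bar>)))"
    by (intro suminf_cong nn_integral_eq_integral integrable_bounded_measurable babs) auto
  also have "\<dots> \<le> (\<Sum>n. ennreal ((1/2) ^ n))"
    by (intro suminf_le ennreal_leI L1) auto
  also have "\<dots> = ennreal (\<Sum>n. (1/2) ^ n)"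
    by (intro suminf_ennreal2 summable_geometric) auto
  also have "\<dots> < \<infinity>" by simp
  finally have "AE x in M. (\<Sum>n. ennreal \<bar>d n x\<bar>) \<noteq> \<infinity>"
    using bd by (intro nn_integral_noteq_infinite) auto
  then show ?thesis
  proof eventually_elim
    case (elim x)
    then have "summable (\<lambda>n. \<bar>d n x\<bar>)"
      by (intro summable_suminf_not_top) auto
    then have "summable (\<lambda>n. d n x)" by (rule summable_rabs_cancel)
    then have "convergent (\<lambda>n. \<Sum>i<n. d i x)" by (simp add: summable_iff_convergent)
    then have "convergent (\<lambda>n. f 0 x + (\<Sum>i<n. d i x))"
      by (intro convergent_add convergent_const)
    then show ?case 
      using sum_lessThan_telescope[of "\<lambda>i. f i x"] by (simp add: d_def)
  qed
qed

text \<open>Only dyadic convex combinations of \<open>S\<close>. The parallelogram law uses nothing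
  but midpoints, and every linear property of the hull follows by rule induction.\<close>

inductive_set midpoint_hull :: "('a \<Rightarrow> real) set \<Rightarrow> ('a \<Rightarrow> real) set" for S where
  base: "f \<in> S \<Longrightarrow> f \<in> midpoint_hull S"
| mid: "f \<in> midpoint_hull S \<Longrightarrow> g \<in> midpoint_hull S \<Longrightarrow>
    (\<lambda>x. (f x + g x) / 2) \<in> midpoint_hull S"

section \<open>Measure preserving actions of abelian groups\<close>

locale mp_action = prob_space M for M :: "'a measure" +
  fixes T :: "'v::ab_group_add \<Rightarrow> 'a \<Rightarrow> 'a"
  assumes space_UNIV: "space M = UNIV"
    and T_measurable [measurable]: "T v \<in> measurable M M"
    and T_distr: "distr M M (T v) = M"
    and T_zero: "T 0 x = x"
    and T_add: "T (v + w) x = T v (T w x)"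
begin

lemma expectation_T:
  fixes f :: "'a \<Rightarrow> real"
  assumes "f \<in> borel_measurable M"
  shows "expectation (\<lambda>x. f (T v x)) = expectation f"
  using integral_distr[OF T_measurable[of v] assms] by (simp add: T_distr)

lemma vimage_T_sets: "A \<in> sets M \<Longrightarrow> T v -` A \<in> sets M"
  using measurable_sets[OF T_measurable[of v], of A] by (simp add: space_UNIV)

lemma prob_vimage_T: "A \<in> sets M \<Longrightarrow> prob (T v -` A) = prob A"
  using measure_distr[OF T_measurable[of v], of A] by (simp add: T_distr space_UNIV)

lemma bounded_measurable_T:
  "bounded_measurable M f \<Longrightarrow> bounded_measurable M (\<lambda>x. f (T v x))"
  using bounded_measurable_comp T_measurable by blast

lemma AE_T: "AE x in M. P x \<Longrightarrow> AE x in M. P (T v x)"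
  by (rule AE_distrD[OF T_measurable]) (simp only: T_distr)

text \<open>The element of minimal norm in the closed convex hull of an orbit is invariant.\<close>

lemma ergodic_correlation:
  fixes \<Phi> :: "'a \<Rightarrow> real" and \<Gamma> :: "'v set"
  assumes cnt: "countable \<Gamma>" and zero: "0 \<in> \<Gamma>"
    and plus: "\<And>v w. v \<in> \<Gamma> \<Longrightarrow> w \<in> \<Gamma> \<Longrightarrow> v + w \<in> \<Gamma>"
    and minus: "\<And>v w. v \<in> \<Gamma> \<Longrightarrow> w \<in> \<Gamma> \<Longrightarrow> v - w \<in> \<Gamma>"
    and erg: "\<And>A. A \<in> sets M \<Longrightarrow> (\<And>v. v \<in> \<Gamma> \<Longrightarrow> T v -` A = A) \<Longrightarrow> prob A = 0 \<or> prob A = 1"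
    and \<Phi>: "bounded_measurable M \<Phi>" "expectation \<Phi> = 0" and e: "0 < e"
  shows "\<exists>v\<in>\<Gamma>. expectation (\<lambda>x. \<Phi> x * \<Phi> (T v x)) < e"
proof (rule ccontr)
  assume "\<not> ?thesis"
  then have corr: "e \<le> expectation (\<lambda>x. \<Phi> x * \<Phi> (T v x))" if "v \<in> \<Gamma>" for v
    using that by force
  note [measurable] = bounded_measurable_measurable[OF \<Phi>(1)]
  obtain C where C: "\<bar>\<Phi> x\<bar> \<le> C" for x
    using \<Phi>(1) unfolding bounded_measurable_def by blast
  \<comment> \<open>Inner products are linear in each argument, so the lower bound \<open>e\<close>
    on the correlations along the orbit passes to all pairs in the hull. The minimal vector is then
    nonzero with mean zero, while ergodicity will force it to vanish.\<close>
  define H where "H = midpoint_hull ((\<lambda>v x. \<Phi> (T v x)) ` \<Gamma>)"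
  have HC: "\<bar>f x\<bar> \<le> C" if "f \<in> H" for f x
    using that unfolding H_def
  proof (induction arbitrary: x rule: midpoint_hull.induct)
    case (mid f g)
    have "\<bar>f x + g x\<bar> \<le> C + C" using mid.IH[of x] abs_triangle_ineq[of "f x" "g x"] by linarith
    then show ?case by simp
  qed (use C in auto)
  have Hb: "bounded_measurable M f" if "f \<in> H" for f
    using that unfolding H_def
  proof (induction rule: midpoint_hull.induct)
    case (mid f g)
    then have "bounded_measurable M (\<lambda>x. (f x + g x) * (1 / 2))"
      by (intro bounded_measurable_mult bounded_measurable_add bounded_measurable_const)
    then show ?case by simp
  qed (use \<Phi>(1) bounded_measurable_T in auto)
  note Hi = integrable_bounded_measurable[OF Hb]
  have Hmid: "(\<lambda>x. (f x + g x) / 2) \<in> H" if "f \<in> H" "g \<in> H" for f g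
    using that unfolding H_def by (rule midpoint_hull.mid)
  have H0: "expectation f = 0" if "f \<in> H" for f
    using that unfolding H_def
  proof (induction rule: midpoint_hull.induct)
    case (mid f g)
    then show ?case using Hi[unfolded H_def] by simp
  qed (use \<Phi> expectation_T[of \<Phi>] in \<open>auto dest: bounded_measurable_measurable\<close>)
  have HT: "(\<lambda>x. f (T w x)) \<in> H" if "f \<in> H" "w \<in> \<Gamma>" for f w
    using that(1) unfolding H_def
  proof (induction rule: midpoint_hull.induct)
    case (base f)
    then obtain v where "v \<in> \<Gamma>" "f = (\<lambda>x. \<Phi> (T v x))" by blast
    then have "(\<lambda>x. f (T w x)) = (\<lambda>x. \<Phi> (T (v + w) x))" "v + w \<in> \<Gamma>"
      using plus that(2) by (auto simp: T_add)
    then show ?case by (intro midpoint_hull.base) auto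
  next
    case (mid f g)
    then show ?case
      using midpoint_hull.mid[of "\<lambda>x. f (T w x)" _ "\<lambda>x. g (T w x)"] by simp
  qed
  have base_corr: "e \<le> expectation (\<lambda>x. \<Phi> (T v x) * \<Phi> (T w x))" if "v \<in> \<Gamma>" "w \<in> \<Gamma>" for v w
  proof -
    have "expectation (\<lambda>x. \<Phi> (T v x) * \<Phi> (T (w - v) (T v x)))
        = expectation (\<lambda>x. \<Phi> x * \<Phi> (T (w - v) x))"
      by (intro expectation_T[where f = "\<lambda>x. \<Phi> x * \<Phi> (T (w - v) x)"]) measurable
    then show ?thesis using corr[OF minus[OF that(2,1)]] by (simp add: T_add[symmetric])
  qed
  have Hcorr1: "e \<le> expectation (\<lambda>x. f x * \<Phi> (T w x))" if "f \<in> H" "w \<in> \<Gamma>" for f w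
    using that(1) unfolding H_def
  proof (induction rule: midpoint_hull.induct)
    case (mid f g)
    have i: "integrable M (\<lambda>x. f x * \<Phi> (T w x))" "integrable M (\<lambda>x. g x * \<Phi> (T w x))"
      using mid Hb[unfolded H_def] \<Phi>(1) bounded_measurable_T
      by (auto intro!: integrable_bounded_measurable bounded_measurable_mult)
    have "expectation (\<lambda>x. (f x + g x) / 2 * \<Phi> (T w x))
      = expectation (\<lambda>x. (f x * \<Phi> (T w x) + g x * \<Phi> (T w x)) / 2)"
      by (simp add: algebra_simps)
    also have "\<dots> = (expectation (\<lambda>x. f x * \<Phi> (T w x)) + expectation (\<lambda>x. g x * \<Phi> (T w x))) / 2"
      using i by simp
    finally show ?case using mid.IH by simp
  qed (use base_corr that(2) in auto)
  have Hcorr: "e \<le> expectation (\<lambda>x. g x * f x)" if "f \<in> H" "g \<in> H" for f g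
    using that(1) unfolding H_def
  proof (induction rule: midpoint_hull.induct)
    case (mid f f')
    have i: "integrable M (\<lambda>x. g x * f x)" "integrable M (\<lambda>x. g x * f' x)"
      using mid that Hb unfolding H_def
      by (auto intro!: integrable_bounded_measurable bounded_measurable_mult)
    have "expectation (\<lambda>x. g x * ((f x + f' x) / 2))
      = expectation (\<lambda>x. (g x * f x + g x * f' x) / 2)"
      by (simp add: algebra_simps)
    also have "\<dots> = (expectation (\<lambda>x. g x * f x) + expectation (\<lambda>x. g x * f' x)) / 2"
      using i by simp
    finally show ?case using mid.IH by simp
  qed (use Hcorr1[OF that(2)] in auto)
  have Hne: "\<Phi> \<in> H"
  proof -
    have "(\<lambda>x. \<Phi> (T 0 x)) \<in> H"
      unfolding H_def using zero by (intro midpoint_hull.base) blast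
    then show ?thesis by (simp add: T_zero)
  qed
  define N :: "('a \<Rightarrow> real) \<Rightarrow> real" where "N f = expectation (\<lambda>x. f x * f x)" for f
  define D where "D = (INF f\<in>H. N f)"
  have bdd: "bdd_below (N ` H)" using Hcorr unfolding N_def by (auto intro!: bdd_belowI2)
  have D_le: "D \<le> N f" if "f \<in> H" for f
    unfolding D_def using bdd that by (rule cINF_lower)
  have e_le_D: "e \<le> D" unfolding D_def using Hne Hcorr by (intro cINF_greatest) (auto simp: N_def)
  \<comment> \<open>The parallelogram law: the midpoint lies in \<open>H\<close>, hence has squared
    norm at least \<open>D\<close>.\<close>
  have close: "expectation (\<lambda>x. (f x - g x)\<^sup>2) \<le> 2 * (N f - D) + 2 * (N g - D)"
    if "f \<in> H" "g \<in> H" for f g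
  proof -
    define m where "m = (\<lambda>x. (f x + g x) / 2)"
    have m: "m \<in> H" unfolding m_def by (rule Hmid[OF that])
    have i: "integrable M (\<lambda>x. f x * f x)" "integrable M (\<lambda>x. g x * g x)"
        "integrable M (\<lambda>x. m x * m x)"
      by (intro integrable_bounded_measurable bounded_measurable_mult Hb m that)+
    have "expectation (\<lambda>x. (f x - g x)\<^sup>2)
        = expectation (\<lambda>x. 2 * (f x * f x) + 2 * (g x * g x) - 4 * (m x * m x))"
      by (intro Bochner_Integration.integral_cong)
        (auto simp: m_def power2_eq_square algebra_simps)
    also have "\<dots> = 2 * N f + 2 * N g - 4 * N m"
      unfolding N_def using i by simp
    finally show ?thesis using D_le[OF m] by simp
  qed
  \<comment> \<open>With these gaps \<open>close\<close> bounds consecutive distances by 5/8 of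
    \<open>(1/4) ^ n\<close>, within the rate required for almost everywhere convergence.\<close>
  have "\<exists>f\<in>H. N f < D + (1/4) ^ Suc n" for n :: nat
    using cINF_less_iff[OF _ bdd, of "D + (1/4) ^ Suc n"] Hne by (auto simp: D_def)
  then obtain f where f: "f n \<in> H" "N (f n) < D + (1/4) ^ Suc n" for n :: nat
    by metis
  have "expectation (\<lambda>x. (f (Suc n) x - f n x)\<^sup>2) \<le> (1/4) ^ n" for n
  proof -
    define p where "p = (1/4 :: real) ^ n"
    have "0 < p" "N (f n) < D + p / 4" "N (f (Suc n)) < D + p / 16"
      using f(2)[of n] f(2)[of "Suc n"] by (simp_all add: p_def)
    then show ?thesis
      using close[OF f(1)[of "Suc n"] f(1)[of n]] unfolding p_def[symmetric] by argo
  qed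
  then have conv: "AE x in M. convergent (\<lambda>n. f n x)"
    by (intro AE_convergent_of_L2_summable Hb f)
  define \<Psi> where "\<Psi> = (\<lambda>x. lim (\<lambda>n. f n x))"
  note fb [measurable] = bounded_measurable_measurable[OF Hb[OF f(1)]]
  have \<Psi> [measurable]: "\<Psi> \<in> borel_measurable M"
    unfolding \<Psi>_def by (intro borel_measurable_lim_metric) measurable
  have lim: "AE x in M. (\<lambda>n. f n x) \<longlonglongrightarrow> \<Psi> x"
    using conv by eventually_elim (simp add: \<Psi>_def convergent_LIMSEQ_iff)
  have "(\<lambda>n. expectation (f n)) \<longlonglongrightarrow> expectation \<Psi>"
    using lim HC[OF f(1)]
    by (intro integral_dominated_convergence[where w = "\<lambda>_. C"]) auto
  then have E0: "expectation \<Psi> = 0"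
    using H0[OF f(1)] by (simp add: LIMSEQ_const_iff)
  have "(\<lambda>n. N (f n)) \<longlonglongrightarrow> expectation (\<lambda>x. \<Psi> x * \<Psi> x)" unfolding N_def
  proof (intro integral_dominated_convergence[where w = "\<lambda>_. C * C"])
    show "AE x in M. (\<lambda>n. f n x * f n x) \<longlonglongrightarrow> \<Psi> x * \<Psi> x"
      using lim by eventually_elim (intro tendsto_mult)
    have "\<bar>f n x * f n x\<bar> \<le> C * C" for n x
      unfolding abs_mult using HC[OF f(1)[of n], of x] by (intro mult_mono) auto
    then show "AE x in M. norm (f n x * f n x) \<le> C * C" for n by simp
  qed auto
  moreover have "e \<le> N (f n)" for n
    using D_le[OF f(1)[of n]] e_le_D by linarith
  ultimately have "e \<le> expectation (\<lambda>x. \<Psi> x * \<Psi> x)"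
    by (intro LIMSEQ_le_const) blast+
  then have Enz: "expectation (\<lambda>x. \<Psi> x * \<Psi> x) \<noteq> 0" using e by simp
  have C0: "0 \<le> C" using C[of undefined] by simp
  \<comment> \<open>\<open>f n\<close> and its translate both lie in \<open>H\<close> and have the
    same almost minimal norm, so \<open>close\<close> brings them together.\<close>
  have inv: "AE x in M. \<Psi> (T w x) = \<Psi> x" if w: "w \<in> \<Gamma>" for w
  proof -
    have limT: "AE x in M. (\<lambda>n. f n (T w x)) \<longlonglongrightarrow> \<Psi> (T w x)"
      using AE_T[OF lim] .
    have NT: "N (\<lambda>x. f n (T w x)) = N (f n)" for n
      unfolding N_def by (intro expectation_T[where f = "\<lambda>x. f n x * f n x"]) measurable
    have "(\<lambda>n. expectation (\<lambda>x. (f n (T w x) - f n x)\<^sup>2))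
        \<longlonglongrightarrow> expectation (\<lambda>x. (\<Psi> (T w x) - \<Psi> x)\<^sup>2)"
    proof (intro integral_dominated_convergence[where w = "\<lambda>_. (2 * C)\<^sup>2"])
      show "AE x in M. (\<lambda>n. (f n (T w x) - f n x)\<^sup>2) \<longlonglongrightarrow> (\<Psi> (T w x) - \<Psi> x)\<^sup>2"
        using lim limT by eventually_elim (intro tendsto_intros)
      have "\<bar>f n (T w x) - f n x\<bar> \<le> 2 * C" for n x
        using HC[OF f(1)[of n], of "T w x"] HC[OF f(1)[of n], of x] by linarith
      then have "(f n (T w x) - f n x)\<^sup>2 \<le> (2 * C)\<^sup>2" for n x
        using C0 by (intro abs_le_square_iff[THEN iffD1]) simp
      then show "AE x in M. norm ((f n (T w x) - f n x)\<^sup>2) \<le> (2 * C)\<^sup>2" for n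
        by simp
    qed auto
    moreover have "(\<lambda>n. expectation (\<lambda>x. (f n (T w x) - f n x)\<^sup>2)) \<longlonglongrightarrow> 0"
    proof (rule tendsto_sandwich[OF _ _ tendsto_const])
      have "expectation (\<lambda>x. (f n (T w x) - f n x)\<^sup>2) \<le> (1/4) ^ n" for n
        using close[OF HT[OF f(1)[of n] w] f(1)[of n]] f(2)[of n] unfolding NT by simp
      then show "\<forall>\<^sub>F n in sequentially. expectation (\<lambda>x. (f n (T w x) - f n x)\<^sup>2) \<le> (1/4) ^ n"
        by simp
      show "(\<lambda>n. (1/4 :: real) ^ n) \<longlonglongrightarrow> 0" by (intro LIMSEQ_power_zero) simp
    qed simp
    ultimately have "expectation (\<lambda>x. (\<Psi> (T w x) - \<Psi> x)\<^sup>2) = 0"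
      using LIMSEQ_unique by blast
    moreover have "integrable M (\<lambda>x. (\<Psi> (T w x) - \<Psi> x)\<^sup>2)"
    proof (rule integrable_const_bound[where B = "(2 * C)\<^sup>2"])
      have Cb: "AE x in M. \<bar>\<Psi> x\<bar> \<le> C"
        using lim
      proof eventually_elim
        case (elim x)
        then have "(\<lambda>n. \<bar>f n x\<bar>) \<longlonglongrightarrow> \<bar>\<Psi> x\<bar>" by (rule tendsto_rabs)
        then show ?case using HC[OF f(1)] by (intro LIMSEQ_le_const2) blast+
      qed
      show "AE x in M. norm ((\<Psi> (T w x) - \<Psi> x)\<^sup>2) \<le> (2 * C)\<^sup>2"
        using Cb AE_T[OF Cb, of w]
      proof eventually_elim
        case (elim x)
        then have "\<bar>\<Psi> (T w x) - \<Psi> x\<bar> \<le> \<bar>2 * C\<bar>" by linarith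
        then show ?case by (simp only: abs_le_square_iff) simp
      qed
    qed measurable
    ultimately have "AE x in M. (\<Psi> (T w x) - \<Psi> x)\<^sup>2 = 0"
      by (subst (asm) integral_nonneg_eq_0_iff_AE) auto
    then show ?thesis by eventually_elim simp
  qed
  have i\<Psi>: "integrable M \<Psi>"
  proof (rule integrable_const_bound[where B = C])
    show "AE x in M. norm (\<Psi> x) \<le> C"
      using lim
    proof eventually_elim
      case (elim x)
      then have "(\<lambda>n. \<bar>f n x\<bar>) \<longlonglongrightarrow> \<bar>\<Psi> x\<bar>" by (rule tendsto_rabs)
      then show ?case using HC[OF f(1)] unfolding real_norm_def by (intro LIMSEQ_le_const2) blast+
    qed
  qed measurable
  \<comment> \<open>Bounding the upper tail suffices: once \<open>\<Psi>\<close> is at most 0 almost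
    everywhere, its mean zero makes it vanish.\<close>
  have null: "AE x in M. \<Psi> x \<le> c" if "0 < c" for c
  proof -
    \<comment> \<open>\<open>\<Psi>\<close> is invariant only almost everywhere, whereas
      \<open>erg\<close> asks for strict invariance. Quantifying over the whole group gives a
      strictly invariant set, measurable because \<open>\<Gamma>\<close> is countable, which agrees
      with the superlevel set up to a null set.\<close>
    define B where "B = {x. \<forall>v\<in>\<Gamma>. c < \<Psi> (T v x)}"
    have B: "B \<in> sets M"
    proof -
      have "{x \<in> space M. \<forall>v\<in>\<Gamma>. c < \<Psi> (T v x)} \<in> sets M"
        using cnt by measurable
      then show ?thesis by (simp add: B_def space_UNIV)
    qed
    have "T w -` B = B" if "w \<in> \<Gamma>" for w
    proof (intro set_eqI iffI)
      fix x assume "x \<in> T w -` B"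
      then have "c < \<Psi> (T v (T w x))" if "v \<in> \<Gamma>" for v using that by (auto simp: B_def)
      then have "c < \<Psi> (T (v - w + w) x)" if "v \<in> \<Gamma>" for v
        using minus[OF that \<open>w \<in> \<Gamma>\<close>] by (metis T_add)
      then show "x \<in> B" by (simp add: B_def)
    next
      fix x assume "x \<in> B"
      then have "c < \<Psi> (T (v + w) x)" if "v \<in> \<Gamma>" for v
        using plus[OF that \<open>w \<in> \<Gamma>\<close>] by (auto simp: B_def)
      then show "x \<in> T w -` B" by (simp add: B_def T_add)
    qed
    from erg[OF B this] have "prob B = 0 \<or> prob B = 1" .
    moreover have "prob B \<noteq> 1"
    proof
      assume "prob B = 1"
      then have "AE x in M. x \<in> B" using B by (simp add: AE_in_set_eq_1)
      then have "AE x in M. c \<le> \<Psi> x"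
        by eventually_elim (use zero in \<open>auto simp: B_def T_zero dest!: bspec[of _ _ 0]\<close>)
      then have "expectation (\<lambda>_. c) \<le> expectation \<Psi>"
        using i\<Psi> by (intro integral_mono_AE) auto
      then show False using E0 that by (simp add: prob_space)
    qed
    ultimately have "AE x in M. x \<notin> B"
      using B by (simp add: AE_iff_measurable[OF B] space_UNIV emeasure_eq_measure)
    moreover have "AE x in M. \<forall>v\<in>\<Gamma>. \<Psi> (T v x) = \<Psi> x"
      using cnt inv by (simp add: AE_ball_countable)
    ultimately show ?thesis
      by eventually_elim (auto simp: B_def not_less)
  qed
  have "AE x in M. \<forall>n. \<Psi> x \<le> 1 / real (Suc n)"
    unfolding AE_all_countable by (intro allI null) simp
  then have "AE x in M. \<Psi> x \<le> 0"
  proof eventually_elim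
    case (elim x)
    have "(\<lambda>n. 1 / real (Suc n)) \<longlonglongrightarrow> 0" by (rule LIMSEQ_Suc[OF lim_const_over_n])
    then show ?case using elim by (intro LIMSEQ_le_const) blast+
  qed
  then have "AE x in M. - \<Psi> x = 0"
    using E0 i\<Psi> by (subst integral_nonneg_eq_0_iff_AE[symmetric]) auto
  then have "AE x in M. \<Psi> x * \<Psi> x = 0" by eventually_elim simp
  then have "expectation (\<lambda>x. \<Psi> x * \<Psi> x) = 0"
    by (subst integral_cong_AE[where g = "\<lambda>_. 0"]) auto
  then show False using Enz by contradiction
qed

end

section \<open>Mixing along a filter\<close>

text \<open>An \<open>e/3\<close> argument: the error \<open>b n\<close> does not depend on the
  point \<open>v\<close>, so the limit along \<open>F\<close> commutes with the approximation. It
  carries limits to countable unions and to integrable functions.\<close>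

lemma tendsto_uniform_limit:
  fixes \<psi> :: "'b \<Rightarrow> real"
  assumes lim: "\<And>n::nat. (\<phi> n \<longlongrightarrow> l n) F" and b: "b \<longlonglongrightarrow> 0"
    and \<phi>: "\<And>n v. \<bar>\<phi> n v - \<psi> v\<bar> \<le> b n" and l: "\<And>n. \<bar>l n - k\<bar> \<le> b n"
  shows "(\<psi> \<longlongrightarrow> k) F"
proof (rule tendstoI)
  fix e :: real assume "0 < e"
  then have "\<forall>\<^sub>F n in sequentially. b n < e / 3" using b by (intro order_tendstoD) auto
  then obtain n where n: "b n < e / 3" by (auto simp: eventually_sequentially)
  have "\<forall>\<^sub>F v in F. dist (\<phi> n v) (l n) < e / 3" using lim \<open>0 < e\<close> by (intro tendstoD) auto
  then show "\<forall>\<^sub>F v in F. dist (\<psi> v) k < e"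
  proof eventually_elim
    case (elim v)
    then show ?case using \<phi>[of n v] l[of n] n unfolding dist_real_def by linarith
  qed
qed

text \<open>A Dynkin class argument; domination by a fixed measure makes the convergence of the partial
  sums uniform along the filter.\<close>

lemma (in prob_space) tendsto_sigma_sets:
  fixes \<rho> :: "'b \<Rightarrow> 'a set \<Rightarrow> real"
  assumes E: "Int_stable E" "E \<subseteq> Pow (space M)" "sets M = sigma_sets (space M) E" "space M \<in> E"
    and pos: "\<And>v B. B \<in> sets M \<Longrightarrow> 0 \<le> \<rho> v B"
    and dom: "\<And>v B. B \<in> sets M \<Longrightarrow> \<rho> v B \<le> prob B"
    and add: "\<And>v A B. A \<in> sets M \<Longrightarrow> B \<in> sets M \<Longrightarrow> A \<inter> B = {} \<Longrightarrow> \<rho> v (A \<union> B) = \<rho> v A + \<rho> v B"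
    and lim: "\<And>B. B \<in> E \<Longrightarrow> ((\<lambda>v. \<rho> v B) \<longlongrightarrow> \<kappa> * prob B) F"
    and B: "B \<in> sets M"
  shows "((\<lambda>v. \<rho> v B) \<longlongrightarrow> \<kappa> * prob B) F"
  using E(1,2) B[unfolded E(3)]
proof (induction rule: sigma_sets_induct_disjoint)
  case (basic A)
  then show ?case by (rule lim)
next
  case empty
  have "\<rho> v {} = 0" for v using pos[of "{}" v] dom[of "{}" v] by simp
  then show ?case by simp
next
  case (compl A)
  have A: "A \<in> sets M" using compl.hyps E(3) by simp
  have "\<rho> v (space M - A) = \<rho> v (space M) - \<rho> v A" for v
    using add[of A "space M - A" v] A sets.sets_into_space[OF A] by (simp add: Un_absorb1)
  moreover have "prob (space M - A) = prob (space M) - prob A"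
    using A by (simp add: prob_compl prob_space)
  ultimately show ?case
    using tendsto_diff[OF lim[OF E(4)] compl.IH] by (simp add: right_diff_distrib)
next
  case (union A)
  have A: "A i \<in> sets M" for i using union.hyps(2) E(3) by auto
  define R where "R n = (\<Union>i\<in>{n..}. A i)" for n
  have R: "R n \<in> sets M" for n unfolding R_def using A by auto
  have dR: "(\<Union>i<n. A i) \<inter> R n = {}" for n
  proof -
    have "A i \<inter> A j = {}" if "i < n" "n \<le> j" for i j
      using disjoint_family_onD[OF union.hyps(1), of i j] that by auto
    then show ?thesis unfolding R_def by blast
  qed
  have UR: "(\<Union>i. A i) = (\<Union>i<n. A i) \<union> R n" for n
  proof -
    have "UNIV = {..<n} \<union> {n..}" by auto
    then show ?thesis unfolding R_def by (metis UN_Un)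
  qed
  have rfin: "\<rho> v (\<Union>i<n. A i) = (\<Sum>i<n. \<rho> v (A i))" for v n
  proof (induction n)
    case 0
    show ?case using pos[of "{}" v] dom[of "{}" v] by simp
  next
    case (Suc n)
    have "(\<Union>i<n. A i) \<inter> A n = {}" using dR[of n] unfolding R_def by fastforce
    then have "\<rho> v ((\<Union>i<n. A i) \<union> A n) = \<rho> v (\<Union>i<n. A i) + \<rho> v (A n)"
      using A by (intro add) auto
    then show ?case using Suc by (simp add: lessThan_Suc Un_commute add.commute)
  qed
  have pfin: "prob (\<Union>i<n. A i) = (\<Sum>i<n. prob (A i))" for n
    using A union.hyps(1) by (intro finite_measure_finite_Union)
      (auto simp: disjoint_family_on_def)
  have \<rho>R: "\<rho> v (\<Union>i. A i) = (\<Sum>i<n. \<rho> v (A i)) + \<rho> v (R n)" for v n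
    unfolding UR[of n] rfin[symmetric] using A R dR by (intro add) auto
  have pR: "prob (\<Union>i. A i) = (\<Sum>i<n. prob (A i)) + prob (R n)" for n
    unfolding UR[of n] pfin[symmetric] using A R dR by (intro finite_measure_Union) auto
  \<comment> \<open>One bound has to serve both errors: the tail \<open>R n\<close> costs
    \<open>prob (R n)\<close> on the side of \<open>\<rho>\<close> by domination and
    \<open>\<bar>\<kappa>\<bar> * prob (R n)\<close> in the limits, whence the factor
    \<open>1 + \<bar>\<kappa>\<bar>\<close>.\<close>
  show ?case
  proof (rule tendsto_uniform_limit[where \<phi> = "\<lambda>n v. \<Sum>i<n. \<rho> v (A i)"
        and l = "\<lambda>n. \<Sum>i<n. \<kappa> * prob (A i)" and b = "\<lambda>n. (1 + \<bar>\<kappa>\<bar>) * prob (R n)"])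
    show "((\<lambda>v. \<Sum>i<n. \<rho> v (A i)) \<longlongrightarrow> (\<Sum>i<n. \<kappa> * prob (A i))) F" for n
      using union.IH by (intro tendsto_sum) auto
    have "(\<lambda>n. \<Sum>i<n. prob (A i)) \<longlonglongrightarrow> prob (\<Union>i. A i)"
      using finite_measure_UNION[of A] A union.hyps(1) by (auto simp: sums_def)
    then have "(\<lambda>n. prob (\<Union>i. A i) - (\<Sum>i<n. prob (A i)))
        \<longlonglongrightarrow> prob (\<Union>i. A i) - prob (\<Union>i. A i)"
      by (intro tendsto_diff tendsto_const)
    moreover have "prob (\<Union>i. A i) - (\<Sum>i<n. prob (A i)) = prob (R n)" for n
      using pR[of n] by simp
    ultimately have "(\<lambda>n. prob (R n)) \<longlonglongrightarrow> 0" by simp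
    then show "(\<lambda>n. (1 + \<bar>\<kappa>\<bar>) * prob (R n)) \<longlonglongrightarrow> 0" by (rule tendsto_mult_right_zero)
    show "\<bar>(\<Sum>i<n. \<rho> v (A i)) - \<rho> v (\<Union>i. A i)\<bar> \<le> (1 + \<bar>\<kappa>\<bar>) * prob (R n)" for n v
    proof -
      have "0 \<le> \<bar>\<kappa>\<bar> * prob (R n)" by simp
      then show ?thesis
        using \<rho>R[of v n] pos[OF R, of v n] dom[OF R, of v n] unfolding distrib_right by linarith
    qed
    show "\<bar>(\<Sum>i<n. \<kappa> * prob (A i)) - \<kappa> * prob (\<Union>i. A i)\<bar> \<le> (1 + \<bar>\<kappa>\<bar>) * prob (R n)" for n
      unfolding pR[of n] sum_distrib_left[symmetric] by (simp add: abs_mult algebra_simps)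
  qed
qed

text \<open>A weakly mixing action need not mix along all group elements tending to infinity. A
  filter records the good directions and can be restricted or shifted without extracting
  subsequences.\<close>

definition mixing_along :: "'a measure \<Rightarrow> ('v \<Rightarrow> 'a \<Rightarrow> 'a) \<Rightarrow> 'v filter \<Rightarrow> bool" where
  "mixing_along M T F \<longleftrightarrow> (\<forall>A\<in>sets M. \<forall>B\<in>sets M.
     ((\<lambda>v. measure M (A \<inter> T v -` B)) \<longlongrightarrow> measure M A * measure M B) F)"

text \<open>Dominated convergence; the factor 2 in \<open>bound\<close> is the one supplied by the
  limit case of \<open>integrable_induct\<close>.\<close>

lemma (in finite_measure) L1_limit:
  fixes f :: "'a \<Rightarrow> real"
  assumes s: "\<And>n. integrable M (s n)" and f: "integrable M f"
    and lim: "\<And>x. x \<in> space M \<Longrightarrow> (\<lambda>n. s n x) \<longlonglongrightarrow> f x"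
    and bound: "\<And>n x. x \<in> space M \<Longrightarrow> norm (s n x) \<le> 2 * norm (f x)"
  shows "(\<lambda>n. \<integral>x. \<bar>s n x - f x\<bar> \<partial>M) \<longlonglongrightarrow> 0"
proof -
  note [measurable] = borel_measurable_integrable[OF f] borel_measurable_integrable[OF s]
  have "(\<lambda>n. \<integral>x. \<bar>s n x - f x\<bar> \<partial>M) \<longlonglongrightarrow> (\<integral>x. 0 \<partial>M)"
  proof (intro integral_dominated_convergence[where w = "\<lambda>x. 3 * \<bar>f x\<bar>"])
    show "AE x in M. (\<lambda>n. \<bar>s n x - f x\<bar>) \<longlonglongrightarrow> 0"
      using lim by (intro AE_I2 tendsto_rabs_zero LIM_zero)
    show "AE x in M. norm \<bar>s n x - f x\<bar> \<le> 3 * \<bar>f x\<bar>" for n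
    proof (intro AE_I2)
      fix x assume "x \<in> space M"
      then have "\<bar>s n x\<bar> \<le> 2 * \<bar>f x\<bar>" using bound[of x n] by simp
      then show "norm \<bar>s n x - f x\<bar> \<le> 3 * \<bar>f x\<bar>" by simp
    qed
    show "integrable M (\<lambda>x. 3 * \<bar>f x\<bar>)" using f by simp
  qed measurable
  then show ?thesis by simp
qed

context mp_action
begin

text \<open>Two approximations in L1. In \<open>g\<close>, against an indicator, the error is
  uniform in \<open>v\<close> because \<open>T v\<close> preserves the measure; in \<open>f\<close>
  it is uniform because \<open>g\<close> is bounded.\<close>

lemma mixing_along_integral:
  fixes f g :: "'a \<Rightarrow> real"
  assumes mix: "mixing_along M T F" and f: "bounded_measurable M f" and g: "bounded_measurable M g"
  shows "((\<lambda>v. expectation (\<lambda>x. f x * g (T v x))) \<longlongrightarrow> expectation f * expectation g) F"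
proof -
  have iT: "integrable M (\<lambda>x. h (T v x))" if "integrable M h" for h :: "'a \<Rightarrow> real" and v
    using that integrable_distr[OF T_measurable[of v], of h] by (simp add: T_distr)
  have iA: "integrable M (\<lambda>x. indicator A x * h (T v x))"
    if "A \<in> sets M" "integrable M h" for A and h :: "'a \<Rightarrow> real" and v
    using integrable_mult_indicator[OF that(1) iT[OF that(2)]] by simp
  have L1: "((\<lambda>v. expectation (\<lambda>x. indicator A x * g (T v x))) \<longlongrightarrow> prob A * expectation g) F"
    if A [measurable]: "A \<in> sets M" and "integrable M g" for A and g :: "'a \<Rightarrow> real"
    using that(2)
  proof (induction rule: integrable_induct)
    case (base B c)
    have "expectation (\<lambda>x. indicator A x * (indicator B (T v x) *\<^sub>R c)) = prob (A \<inter> T v -` B) * c" for v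
    proof -
      have "expectation (\<lambda>x. indicator A x * (indicator B (T v x) *\<^sub>R c))
          = expectation (\<lambda>x. indicator (A \<inter> T v -` B) x * c)"
        by (intro Bochner_Integration.integral_cong) (auto simp: indicator_def)
      then show ?thesis
        using A vimage_T_sets[OF base(1), of v] by simp
    qed
    moreover have "((\<lambda>v. prob (A \<inter> T v -` B) * c) \<longlongrightarrow> prob A * prob B * c) F"
      using mix A base unfolding mixing_along_def by (intro tendsto_mult_right) auto
    ultimately show ?case using base by (simp add: mult.assoc)
  next
    case (add f g)
    show ?case
      using tendsto_add[OF add.IH] add.hyps by (simp add: distrib_left iA A)
  next
    case (lim f s)
    note [measurable] = borel_measurable_integrable[OF lim.hyps(4)] borel_measurable_integrable[OF lim.hyps(1)]
    define b where "b n = expectation (\<lambda>x. \<bar>s n x - f x\<bar>)" for n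
    have b0: "b \<longlonglongrightarrow> 0" unfolding b_def using lim.hyps by (intro L1_limit)
    show ?case
    proof (rule tendsto_uniform_limit[OF lim.IH b0])
      fix n v
      have "\<bar>expectation (\<lambda>x. indicator A x * s n (T v x)) - expectation (\<lambda>x. indicator A x * f (T v x))\<bar>
          = \<bar>expectation (\<lambda>x. indicator A x * (s n (T v x) - f (T v x)))\<bar>"
        using iA[OF A] lim.hyps(1,4) by (simp add: right_diff_distrib)
      also have "\<dots> \<le> expectation (\<lambda>x. \<bar>indicator A x * (s n (T v x) - f (T v x))\<bar>)"
        by (rule integral_abs_bound)
      also have "\<dots> \<le> expectation (\<lambda>x. \<bar>s n (T v x) - f (T v x)\<bar>)"
        using iA[OF A, of "\<lambda>x. s n x - f x" v] iT[of "\<lambda>x. s n x - f x" v] lim.hyps(1,4)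
        by (intro integral_mono) (auto simp: indicator_def)
      also have "\<dots> = b n"
        unfolding b_def by (intro expectation_T[where f = "\<lambda>x. \<bar>s n x - f x\<bar>"]) measurable
      finally show "\<bar>expectation (\<lambda>x. indicator A x * s n (T v x))
        - expectation (\<lambda>x. indicator A x * f (T v x))\<bar> \<le> b n" .
    next
      fix n
      have "\<bar>prob A * expectation (s n) - prob A * expectation f\<bar>
          = prob A * \<bar>expectation (\<lambda>x. s n x - f x)\<bar>"
        using lim.hyps(1,4) by (simp add: right_diff_distrib[symmetric] abs_mult)
      also have "\<dots> \<le> 1 * b n"
        unfolding b_def by (intro mult_mono integral_abs_bound) auto
      finally show "\<bar>prob A * expectation (s n) - prob A * expectation f\<bar> \<le> b n" by simp
    qed
  qed
  obtain C where C: "\<bar>g x\<bar> \<le> C" for x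
    using g unfolding bounded_measurable_def by blast
  have C0: "0 \<le> C" using C[of undefined] by simp
  note [measurable] = bounded_measurable_measurable[OF g]
  have i: "integrable M (\<lambda>x. h x * g (T v x))" if "integrable M h" for h :: "'a \<Rightarrow> real" and v
  proof (rule Bochner_Integration.integrable_bound)
    show "integrable M (\<lambda>x. C * h x)" using that by simp
    have "\<bar>h x\<bar> * \<bar>g (T v x)\<bar> \<le> \<bar>h x\<bar> * C" for x
      using C by (intro mult_left_mono) auto
    then show "AE x in M. norm (h x * g (T v x)) \<le> norm (C * h x)"
      using C0 by (simp add: abs_mult mult.commute)
  qed (use borel_measurable_integrable[OF that] in measurable)
  have "integrable M f" using f by (rule integrable_bounded_measurable)
  then show ?thesis
  proof (induction rule: integrable_induct)
    case (base A c)
    have "((\<lambda>v. expectation (\<lambda>x. indicator A x * g (T v x)) * c) \<longlongrightarrow> prob A * expectation g * c) F"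
      using L1[OF base(1) integrable_bounded_measurable[OF g]] by (rule tendsto_mult_right)
    then show ?case using base by (simp add: mult_ac)
  next
    case (add f f')
    show ?case
      using tendsto_add[OF add.IH] add.hyps by (simp add: distrib_right i)
  next
    case (lim f s)
    note [measurable] = borel_measurable_integrable[OF lim.hyps(4)] borel_measurable_integrable[OF lim.hyps(1)]
    define b where "b n = C * expectation (\<lambda>x. \<bar>s n x - f x\<bar>)" for n
    have b0: "b \<longlonglongrightarrow> 0"
      unfolding b_def using lim.hyps by (intro tendsto_mult_right_zero L1_limit)
    show ?case
    proof (rule tendsto_uniform_limit[OF lim.IH b0])
      fix n v
      have "\<bar>expectation (\<lambda>x. s n x * g (T v x)) - expectation (\<lambda>x. f x * g (T v x))\<bar>
          = \<bar>expectation (\<lambda>x. (s n x - f x) * g (T v x))\<bar>"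
        using i lim.hyps(1,4) by (simp add: left_diff_distrib)
      also have "\<dots> \<le> expectation (\<lambda>x. \<bar>(s n x - f x) * g (T v x)\<bar>)"
        by (rule integral_abs_bound)
      also have "\<dots> \<le> expectation (\<lambda>x. C * \<bar>s n x - f x\<bar>)"
      proof (intro integral_mono)
        show "integrable M (\<lambda>x. \<bar>(s n x - f x) * g (T v x)\<bar>)"
          using i[of "\<lambda>x. s n x - f x" v] lim.hyps(1,4) by (intro integrable_abs) simp
        show "\<bar>(s n x - f x) * g (T v x)\<bar> \<le> C * \<bar>s n x - f x\<bar>" for x
          using mult_right_mono[OF C[of "T v x"] abs_ge_zero[of "s n x - f x"]]
          by (metis abs_mult mult.commute)
      qed (use lim.hyps(1,4) in simp)
      also have "\<dots> = b n" by (simp add: b_def)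
      finally show "\<bar>expectation (\<lambda>x. s n x * g (T v x)) - expectation (\<lambda>x. f x * g (T v x))\<bar> \<le> b n" .
    next
      fix n
      have Eg: "\<bar>expectation g\<bar> \<le> C"
      proof -
        have "\<bar>expectation g\<bar> \<le> expectation (\<lambda>x. \<bar>g x\<bar>)" by (rule integral_abs_bound)
        also have "\<dots> \<le> expectation (\<lambda>x. C)"
          using integrable_bounded_measurable[OF g] C by (intro integral_mono) auto
        finally show ?thesis by (simp add: prob_space)
      qed
      have "\<bar>expectation (s n) * expectation g - expectation f * expectation g\<bar>
          = \<bar>expectation g\<bar> * \<bar>expectation (\<lambda>x. s n x - f x)\<bar>"
        using lim.hyps(1,4) by (simp add: left_diff_distrib[symmetric] abs_mult)
      also have "\<dots> \<le> b n"
        unfolding b_def using Eg C0 by (intro mult_mono integral_abs_bound) auto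
      finally show "\<bar>expectation (s n) * expectation g - expectation f * expectation g\<bar> \<le> b n" .
    qed
  qed
qed

section \<open>The diagonal action on the square\<close>

lemma mp_action_pair: "mp_action (M \<Otimes>\<^sub>M M) (\<lambda>v. map_prod (T v) (T v))"
proof -
  have sfM: "sigma_finite_measure M" by unfold_locales
  interpret pair_prob_space M M ..
  show ?thesis
  proof
    show "map_prod (T v) (T v) \<in> measurable (M \<Otimes>\<^sub>M M) (M \<Otimes>\<^sub>M M)" for v
      unfolding map_prod_def by measurable
    show "distr (M \<Otimes>\<^sub>M M) (M \<Otimes>\<^sub>M M) (map_prod (T v) (T v)) = M \<Otimes>\<^sub>M M" for v
      using pair_measure_distr[OF T_measurable[of v] T_measurable[of v], unfolded T_distr, OF sfM]
      by (simp add: map_prod_def)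
  qed (auto simp: space_pair_measure space_UNIV T_zero T_add)
qed

text \<open>Correlations of rectangles factor into two correlations on \<open>M\<close>. The Dynkin
  class argument then extends the limit in one set at a time.\<close>

lemma mixing_along_pair:
  assumes mix: "mixing_along M T F"
  shows "mixing_along (M \<Otimes>\<^sub>M M) (\<lambda>v. map_prod (T v) (T v)) F"
proof -
  interpret P: mp_action "M \<Otimes>\<^sub>M M" "\<lambda>v. map_prod (T v) (T v)" by (rule mp_action_pair)
  let ?E = "{a \<times> b | a b. a \<in> sets M \<and> b \<in> sets M}" and ?T = "\<lambda>v. map_prod (T v) (T v)"
  have E: "Int_stable ?E" "?E \<subseteq> Pow (space (M \<Otimes>\<^sub>M M))"
      "sets (M \<Otimes>\<^sub>M M) = sigma_sets (space (M \<Otimes>\<^sub>M M)) ?E" "space (M \<Otimes>\<^sub>M M) \<in> ?E"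
    by (rule Int_stable_pair_measure_generator)
      (auto simp: sets_pair_measure space_pair_measure dest: sets.sets_into_space)
  have rect: "P.prob (a \<times> b) = prob a * prob b" if "a \<in> sets M" "b \<in> sets M" for a b
    using that by (simp add: measure_def emeasure_pair_measure_Times enn2real_mult)
  have EE: "((\<lambda>v. P.prob (A \<inter> ?T v -` B)) \<longlongrightarrow> P.prob A * P.prob B) F"
    if AB: "A \<in> ?E" "B \<in> ?E" for A B
  proof -
    obtain a a' b b' where ab: "A = a \<times> a'" "B = b \<times> b'"
      "a \<in> sets M" "a' \<in> sets M" "b \<in> sets M" "b' \<in> sets M"
      using AB by blast
    have "A \<inter> ?T v -` B = (a \<inter> T v -` b) \<times> (a' \<inter> T v -` b')" for v
      unfolding ab by auto
    then have "P.prob (A \<inter> ?T v -` B) = prob (a \<inter> T v -` b) * prob (a' \<inter> T v -` b')" for v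
      using rect[of "a \<inter> T v -` b" "a' \<inter> T v -` b'"] ab vimage_T_sets by simp
    moreover have "((\<lambda>v. prob (a \<inter> T v -` b) * prob (a' \<inter> T v -` b'))
        \<longlongrightarrow> (prob a * prob b) * (prob a' * prob b')) F"
      using mix ab unfolding mixing_along_def by (intro tendsto_mult) auto
    ultimately show ?thesis using ab by (simp add: rect mult_ac)
  qed
  have ES: "((\<lambda>v. P.prob (A \<inter> ?T v -` B)) \<longlongrightarrow> P.prob A * P.prob B) F"
    if A: "A \<in> ?E" and B: "B \<in> sets (M \<Otimes>\<^sub>M M)" for A B
  proof (rule P.tendsto_sigma_sets[OF E _ _ _ EE[OF A] B])
    have As: "A \<in> sets (M \<Otimes>\<^sub>M M)" using A by auto
    fix v B assume B: "B \<in> sets (M \<Otimes>\<^sub>M M)"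
    show "P.prob (A \<inter> ?T v -` B) \<le> P.prob B"
      using P.finite_measure_mono[of "A \<inter> ?T v -` B" "?T v -` B"] P.vimage_T_sets[OF B, of v]
        P.prob_vimage_T[OF B, of v] by simp
    fix C assume C: "C \<in> sets (M \<Otimes>\<^sub>M M)" "B \<inter> C = {}"
    have "A \<inter> ?T v -` (B \<union> C) = (A \<inter> ?T v -` B) \<union> (A \<inter> ?T v -` C)" by auto
    then show "P.prob (A \<inter> ?T v -` (B \<union> C)) = P.prob (A \<inter> ?T v -` B) + P.prob (A \<inter> ?T v -` C)"
      using B C As by (auto intro!: P.finite_measure_Union sets.Int P.vimage_T_sets)
  qed auto
  have "((\<lambda>v. P.prob (A \<inter> ?T v -` B)) \<longlongrightarrow> P.prob B * P.prob A) F"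
    if A: "A \<in> sets (M \<Otimes>\<^sub>M M)" and B: "B \<in> sets (M \<Otimes>\<^sub>M M)" for A B
  proof (rule P.tendsto_sigma_sets[OF E, where \<rho> = "\<lambda>v A. P.prob (A \<inter> ?T v -` B)", OF _ _ _ _ A])
    fix v A assume A: "A \<in> sets (M \<Otimes>\<^sub>M M)"
    show "P.prob (A \<inter> ?T v -` B) \<le> P.prob A"
      using A by (intro P.finite_measure_mono) auto
    fix C assume C: "C \<in> sets (M \<Otimes>\<^sub>M M)" "A \<inter> C = {}"
    have "(A \<union> C) \<inter> ?T v -` B = (A \<inter> ?T v -` B) \<union> (C \<inter> ?T v -` B)" by auto
    then show "P.prob ((A \<union> C) \<inter> ?T v -` B) = P.prob (A \<inter> ?T v -` B) + P.prob (C \<inter> ?T v -` B)"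
      using A C P.vimage_T_sets[OF B, of v] by (auto intro!: P.finite_measure_Union sets.Int)
  next
    fix A assume "A \<in> ?E"
    from ES[OF this B] show "((\<lambda>v. P.prob (A \<inter> ?T v -` B)) \<longlongrightarrow> P.prob B * P.prob A) F"
      by (simp add: mult.commute)
  qed auto
  then show ?thesis unfolding mixing_along_def by (simp add: mult.commute)
qed

text \<open>By pigeonhole one shift \<open>c + \<Delta>\<close> is met frequently along
  \<open>F\<close>. Restricting \<open>F\<close> to it and subtracting \<open>c\<close> preserves
  mixing, since the shift can be moved onto the first event by invariance of the measure.\<close>

lemma mixing_along_finite_index:
  assumes mix: "mixing_along M T F" and F: "F \<noteq> bot" and C: "finite C"
    and ev: "\<forall>\<^sub>F v in F. \<exists>c\<in>C. v - c \<in> \<Delta>"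
  shows "\<exists>F'. F' \<noteq> bot \<and> mixing_along M T F' \<and> (\<forall>\<^sub>F v in F'. v \<in> \<Delta>)"
proof -
  obtain c where c: "\<exists>\<^sub>F v in F. v - c \<in> \<Delta>"
  proof (rule ccontr)
    assume "\<not> thesis"
    then have "\<forall>c\<in>C. \<forall>\<^sub>F v in F. v - c \<notin> \<Delta>" using that by (auto simp: frequently_def)
    then have "\<forall>\<^sub>F v in F. \<forall>c\<in>C. v - c \<notin> \<Delta>" using C by (simp add: eventually_ball_finite)
    with ev have "\<forall>\<^sub>F v in F. False" by eventually_elim auto
    then show False using F by (simp add: trivial_limit_def)
  qed
  define F0 where "F0 = inf F (principal {v. v - c \<in> \<Delta>})"
  define F' where "F' = filtermap (\<lambda>v. v - c) F0"
  have "F0 \<noteq> bot"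
    unfolding F0_def using c by (auto simp: trivial_limit_def eventually_inf_principal frequently_def)
  then have "F' \<noteq> bot" by (simp add: F'_def filtermap_bot_iff)
  moreover have "\<forall>\<^sub>F v in F'. v \<in> \<Delta>"
    unfolding F'_def F0_def eventually_filtermap eventually_inf_principal by simp
  moreover have "mixing_along M T F'"
    unfolding mixing_along_def
  proof (intro ballI)
    fix A B assume AB: "A \<in> sets M" "B \<in> sets M"
    have "prob (A \<inter> T (v - c) -` B) = prob (T c -` A \<inter> T v -` B)" for v
    proof -
      have "T c -` (A \<inter> T (v - c) -` B) = T c -` A \<inter> T v -` B"
        by (auto simp: T_add[symmetric])
      then show ?thesis
        using prob_vimage_T[of "A \<inter> T (v - c) -` B" c] AB vimage_T_sets[OF AB(2)] by simp
    qed
    moreover have "((\<lambda>v. prob (T c -` A \<inter> T v -` B)) \<longlongrightarrow> prob (T c -` A) * prob B) F0"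
      unfolding F0_def using mix AB vimage_T_sets[OF AB(1)]
      by (intro tendsto_mono[OF inf_le1]) (auto simp: mixing_along_def)
    ultimately show "((\<lambda>v. prob (A \<inter> T v -` B)) \<longlongrightarrow> prob A * prob B) F'"
      using AB by (simp add: F'_def filterlim_filtermap prob_vimage_T)
  qed
  ultimately show ?thesis by blast
qed

lemma integral_prod_pair:
  assumes "bounded_measurable M f" "bounded_measurable M g"
  shows "integral\<^sup>L (M \<Otimes>\<^sub>M M) (\<lambda>z. f (fst z) * g (snd z)) = expectation f * expectation g"
proof -
  interpret pair_prob_space M M ..
  note [measurable] = assms[THEN bounded_measurable_measurable]
  obtain C D where "\<And>x. \<bar>f x\<bar> \<le> C" "\<And>x. \<bar>g x\<bar> \<le> D"
    using assms unfolding bounded_measurable_def by blast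
  then have "\<bar>f x * g y\<bar> \<le> C * D" for x y
    unfolding abs_mult by (meson abs_ge_zero mult_mono order_trans)
  then have "integrable (M \<Otimes>\<^sub>M M) (\<lambda>z. f (fst z) * g (snd z))"
    by (intro P.integrable_const_bound[where B = "C * D"]) auto
  from integral_fst'[OF this] show ?thesis by simp
qed

text \<open>On the square, the sum of all squared correlation defects of a finite family of events
  is a single correlation of a function of mean zero. Ergodicity makes it small at some
  \<open>v\<close>, so the sets \<open>good\<close> are nonempty and form a filter base.\<close>

lemma mixing_filter_exists:
  fixes \<Gamma> :: "'v set"
  assumes cnt: "countable \<Gamma>" and zero: "0 \<in> \<Gamma>"
    and plus: "\<And>v w. v \<in> \<Gamma> \<Longrightarrow> w \<in> \<Gamma> \<Longrightarrow> v + w \<in> \<Gamma>"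
    and minus: "\<And>v w. v \<in> \<Gamma> \<Longrightarrow> w \<in> \<Gamma> \<Longrightarrow> v - w \<in> \<Gamma>"
    and erg: "\<And>A. A \<in> sets (M \<Otimes>\<^sub>M M) \<Longrightarrow> (\<And>v. v \<in> \<Gamma> \<Longrightarrow> map_prod (T v) (T v) -` A = A) \<Longrightarrow>
      measure (M \<Otimes>\<^sub>M M) A = 0 \<or> measure (M \<Otimes>\<^sub>M M) A = 1"
  shows "\<exists>F. F \<noteq> bot \<and> mixing_along M T F \<and> (\<forall>\<^sub>F v in F. v \<in> \<Gamma>)"
proof -
  interpret P: mp_action "M \<Otimes>\<^sub>M M" "\<lambda>v. map_prod (T v) (T v)" by (rule mp_action_pair)
  define good where "good \<A> e = {v \<in> \<Gamma>. \<forall>A\<in>\<A>. \<forall>B\<in>\<A>. \<bar>prob (A \<inter> T v -` B) - prob A * prob B\<bar> < e}"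
    for \<A> :: "'a set set" and e :: real
  have good: "good \<A> e \<noteq> {}" if \<A>: "finite \<A>" "\<A> \<subseteq> sets M" and e: "0 < e" for \<A> e
  proof -
    define f where "f A x = indicator A x - prob A" for A :: "'a set" and x
    have bf: "bounded_measurable M (f A)" if "A \<in> \<A>" for A
      using that \<A> unfolding f_def
      by (intro bounded_measurable_diff bounded_measurable_indicator bounded_measurable_const) auto
    have Ef: "expectation (f A) = 0" if "A \<in> \<A>" for A
    proof -
      have "A \<in> sets M" using that \<A> by auto
      moreover from this have "integrable M (indicator A :: 'a \<Rightarrow> real)"
        by (intro integrable_bounded_measurable bounded_measurable_indicator)
      ultimately show ?thesis unfolding f_def by (simp add: prob_space)
    qed
    have fst_meas: "bounded_measurable (M \<Otimes>\<^sub>M M) (\<lambda>z. g (fst z))"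
      if "bounded_measurable M g" for g
      using that measurable_fst by (rule bounded_measurable_comp)
    have snd_meas: "bounded_measurable (M \<Otimes>\<^sub>M M) (\<lambda>z. g (snd z))"
      if "bounded_measurable M g" for g
      using that measurable_snd by (rule bounded_measurable_comp)
    \<comment> \<open>The second coordinate acts as an independent copy and turns each covariance
      into its square, so the terms in \<open>corr\<close> are nonnegative and cannot
      cancel.\<close>
    define \<Phi> where "\<Phi> = (\<lambda>z. \<Sum>A\<in>\<A>. f A (fst z) * f A (snd z))"
    have b\<Phi>: "bounded_measurable (M \<Otimes>\<^sub>M M) \<Phi>"
      unfolding \<Phi>_def by (intro bounded_measurable_sum bounded_measurable_mult fst_meas snd_meas bf)
    have E\<Phi>: "P.expectation \<Phi> = 0"
    proof -
      have "P.expectation \<Phi> = (\<Sum>A\<in>\<A>. P.expectation (\<lambda>z. f A (fst z) * f A (snd z)))"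
        unfolding \<Phi>_def
        by (intro Bochner_Integration.integral_sum P.integrable_bounded_measurable
            bounded_measurable_mult fst_meas snd_meas bf)
      also have "\<dots> = 0" using integral_prod_pair bf Ef by simp
      finally show ?thesis .
    qed
    have corr: "P.expectation (\<lambda>z. \<Phi> z * \<Phi> (map_prod (T v) (T v) z))
        = (\<Sum>A\<in>\<A>. \<Sum>B\<in>\<A>. (prob (A \<inter> T v -` B) - prob A * prob B)\<^sup>2)" for v
    proof -
      define k where "k A B x = f A x * f B (T v x)" for A B x
      have bk: "bounded_measurable M (k A B)" if "A \<in> \<A>" "B \<in> \<A>" for A B
        unfolding k_def using that bf bounded_measurable_T by (intro bounded_measurable_mult) auto
      have Ek: "expectation (k A B) = prob (A \<inter> T v -` B) - prob A * prob B"
        if "A \<in> \<A>" "B \<in> \<A>" for A B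
      proof -
        have s: "A \<in> sets M" "B \<in> sets M" "T v -` B \<in> sets M" "A \<inter> T v -` B \<in> sets M"
          using that \<A> vimage_T_sets by auto
        have "k A B = (\<lambda>x. indicator (A \<inter> T v -` B) x - prob B * indicator A x
            - prob A * indicator (T v -` B) x + prob A * prob B)"
          by (auto simp: k_def f_def fun_eq_iff indicator_def algebra_simps)
        moreover have "integrable M (indicator S :: 'a \<Rightarrow> real)" if "S \<in> sets M" for S
          using that by (intro integrable_bounded_measurable bounded_measurable_indicator)
        ultimately show ?thesis using s by (simp add: prob_space prob_vimage_T)
      qed
      have "(\<lambda>z. \<Phi> z * \<Phi> (map_prod (T v) (T v) z))
          = (\<lambda>z. \<Sum>A\<in>\<A>. \<Sum>B\<in>\<A>. k A B (fst z) * k A B (snd z))"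
        unfolding \<Phi>_def sum_product by (auto simp: k_def fun_eq_iff mult_ac)
      then have "P.expectation (\<lambda>z. \<Phi> z * \<Phi> (map_prod (T v) (T v) z))
          = P.expectation (\<lambda>z. \<Sum>A\<in>\<A>. \<Sum>B\<in>\<A>. k A B (fst z) * k A B (snd z))" by simp
      also have "\<dots> = (\<Sum>A\<in>\<A>. P.expectation (\<lambda>z. \<Sum>B\<in>\<A>. k A B (fst z) * k A B (snd z)))"
        by (intro Bochner_Integration.integral_sum P.integrable_bounded_measurable
            bounded_measurable_sum bounded_measurable_mult fst_meas snd_meas bk)
      also have "\<dots> = (\<Sum>A\<in>\<A>. \<Sum>B\<in>\<A>. P.expectation (\<lambda>z. k A B (fst z) * k A B (snd z)))"
        by (intro sum.cong refl Bochner_Integration.integral_sum P.integrable_bounded_measurable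
            bounded_measurable_mult fst_meas snd_meas bk)
      also have "\<dots> = (\<Sum>A\<in>\<A>. \<Sum>B\<in>\<A>. (prob (A \<inter> T v -` B) - prob A * prob B)\<^sup>2)"
        using integral_prod_pair[OF bk bk] Ek by (simp add: power2_eq_square)
      finally show ?thesis .
    qed
    have "0 < e\<^sup>2" using e by simp
    from P.ergodic_correlation[OF cnt zero plus minus erg b\<Phi> E\<Phi> this]
    obtain v where v: "v \<in> \<Gamma>" "(\<Sum>A\<in>\<A>. \<Sum>B\<in>\<A>. (prob (A \<inter> T v -` B) - prob A * prob B)\<^sup>2) < e\<^sup>2"
      unfolding corr by blast
    have "\<bar>prob (A \<inter> T v -` B) - prob A * prob B\<bar> < e" if "A \<in> \<A>" "B \<in> \<A>" for A B
    proof -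
      have "(prob (A \<inter> T v -` B) - prob A * prob B)\<^sup>2
          \<le> (\<Sum>B\<in>\<A>. (prob (A \<inter> T v -` B) - prob A * prob B)\<^sup>2)"
        using that \<A> by (intro member_le_sum) auto
      also have "\<dots> \<le> (\<Sum>A\<in>\<A>. \<Sum>B\<in>\<A>. (prob (A \<inter> T v -` B) - prob A * prob B)\<^sup>2)"
        using that \<A> by (intro member_le_sum sum_nonneg) auto
      finally have "\<bar>prob (A \<inter> T v -` B) - prob A * prob B\<bar>\<^sup>2 < e\<^sup>2" using v(2) by simp
      then show ?thesis by (rule power2_less_imp_less) (use e in simp)
    qed
    then show ?thesis using v(1) by (auto simp: good_def)
  qed
  \<comment> \<open>Directed: the union of two families with the smaller tolerance refines
    both.\<close>
  define I where "I = {(\<A>, e). finite \<A> \<and> \<A> \<subseteq> sets M \<and> (0 :: real) < e}"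
  define F where "F = (INF (\<A>, e)\<in>I. principal (good \<A> e))"
  have ev: "eventually P F \<longleftrightarrow> (\<exists>(\<A>, e)\<in>I. \<forall>v\<in>good \<A> e. P v)" for P
  proof -
    have "eventually P F \<longleftrightarrow> (\<exists>p\<in>I. eventually P (case p of (\<A>, e) \<Rightarrow> principal (good \<A> e)))"
      unfolding F_def
    proof (rule eventually_INF_base)
      have "({}, 1) \<in> I" by (simp add: I_def)
      then show "I \<noteq> {}" by blast
      fix p q assume "p \<in> I" "q \<in> I"
      then obtain \<A> e \<B> e' where pq: "p = (\<A>, e)" "q = (\<B>, e')" "(\<A>, e) \<in> I" "(\<B>, e') \<in> I"
        by (metis surj_pair)
      then have "(\<A> \<union> \<B>, min e e') \<in> I" by (auto simp: I_def)
      moreover have "good (\<A> \<union> \<B>) (min e e') \<subseteq> good \<A> e \<inter> good \<B> e'"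
        by (auto simp: good_def)
      ultimately show "\<exists>r\<in>I. (case r of (\<A>, e) \<Rightarrow> principal (good \<A> e))
          \<le> inf (case p of (\<A>, e) \<Rightarrow> principal (good \<A> e)) (case q of (\<A>, e) \<Rightarrow> principal (good \<A> e))"
        using pq by (intro bexI[of _ "(\<A> \<union> \<B>, min e e')"]) auto
    qed
    then show ?thesis by (auto simp: eventually_principal split: prod.splits)
  qed
  have "F \<noteq> bot"
    unfolding trivial_limit_def ev using good by (auto simp: I_def)
  moreover have "\<forall>\<^sub>F v in F. v \<in> \<Gamma>"
    unfolding ev by (intro bexI[of _ "({}, 1)"]) (auto simp: I_def good_def)
  moreover have "mixing_along M T F"
    unfolding mixing_along_def
  proof (intro ballI tendstoI)
    fix A B and e :: real assume "A \<in> sets M" "B \<in> sets M" "0 < e"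
    then show "\<forall>\<^sub>F v in F. dist (prob (A \<inter> T v -` B)) (prob A * prob B) < e"
      unfolding ev by (intro bexI[of _ "({A, B}, e)"]) (auto simp: I_def good_def dist_real_def)
  qed
  ultimately show ?thesis by blast
qed

end

section \<open>Functions invariant in different directions\<close>

text \<open>The multiples of \<open>n\<close> have finite index, with coordinatewise remainders as
  representatives. A zero coordinate has remainder and quotient zero, so the vanishing on
  \<open>D\<close> survives.\<close>

lemma mixing_along_multiples:
  fixes T :: "int ^ 'd \<Rightarrow> 'a \<Rightarrow> 'a"
  assumes "mp_action N T" and F: "F \<noteq> bot" "mixing_along N T F" and n: "n \<noteq> 0"
    and D: "\<forall>\<^sub>F v in F. \<forall>c\<in>D. v $ c = 0"
  shows "\<exists>F'. F' \<noteq> bot \<and> mixing_along N T F' \<and> (\<forall>\<^sub>F v in F'. \<exists>w. v = n *s w \<and> (\<forall>c\<in>D. w $ c = 0))"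
proof -
  interpret mp_action N T by fact
  let ?C = "(\<lambda>f. \<chi> i. f i) ` (PiE UNIV (\<lambda>i :: 'd. {0..<\<bar>n\<bar>}))"
    and ?\<Delta> = "{v. \<exists>w. v = n *s w \<and> (\<forall>c\<in>D. w $ c = 0)}"
  have "\<exists>F'. F' \<noteq> bot \<and> mixing_along N T F' \<and> (\<forall>\<^sub>F v in F'. v \<in> ?\<Delta>)"
  proof (rule mixing_along_finite_index[OF F(2,1)])
    show "finite ?C" by (intro finite_imageI finite_PiE) auto
    show "\<forall>\<^sub>F v in F. \<exists>c\<in>?C. v - c \<in> ?\<Delta>"
      using D
    proof eventually_elim
      case (elim v)
      \<comment> \<open>The modulus is \<open>\<bar>n\<bar>\<close>, so that remainders are
        nonnegative for either sign of \<open>n\<close>; \<open>sgn n\<close> restores the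
        sign.\<close>
      have "v - (\<chi> i. v $ i mod \<bar>n\<bar>) = n *s (\<chi> i. sgn n * (v $ i div \<bar>n\<bar>))"
        by (simp add: vec_eq_iff minus_mod_eq_mult_div mult.assoc[symmetric] abs_sgn)
      moreover have "\<forall>c\<in>D. (\<chi> i. sgn n * (v $ i div \<bar>n\<bar>)) $ c = 0" using elim by simp
      ultimately have "v - (\<chi> i. v $ i mod \<bar>n\<bar>) \<in> ?\<Delta>" by blast
      moreover have "(\<lambda>i. v $ i mod \<bar>n\<bar>) \<in> PiE UNIV (\<lambda>i. {0..<\<bar>n\<bar>})" using n by auto
      ultimately show ?case by (intro bexI[OF _ imageI])
    qed
  qed
  then show ?thesis by simp
qed

text \<open>A function invariant under the hyperplane \<open>v\<^sub>a = k * v\<^sub>b\<close> can be averaged along the vector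
  \<open>k e\<^sub>a + e\<^sub>b\<close>; on the functions invariant under another such hyperplane, the multiples of this
  vector act like all of \<open>(k - k0) \<int>\<^sup>d\<close>, hence mixingly.\<close>

lemma invariant_directions_uncorrelated:
  fixes T :: "int ^ 'd \<Rightarrow> 'a \<Rightarrow> 'a" and G :: "int \<Rightarrow> 'a \<Rightarrow> real"
  assumes "mp_action N T" and F: "F \<noteq> bot" "mixing_along N T F" and ab: "a \<noteq> b"
    and K: "finite K" "k0 \<notin> K"
    and "\<And>k. k \<in> insert k0 K \<Longrightarrow> bounded_measurable N (G k)"
    and "\<And>k v x. k \<in> insert k0 K \<Longrightarrow> v $ a = k * v $ b \<Longrightarrow> G k (T v x) = G k x"
    and "integral\<^sup>L N (G k0) = 0"
  shows "integral\<^sup>L N (\<lambda>x. G k0 x * (\<Prod>k\<in>K. G k x)) = 0"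
proof -
  interpret mp_action N T by fact
  have T_comm: "T v (T w x) = T w (T v x)" for v w x
    by (metis T_add add.commute)
  show ?thesis
    using K assms(7-)
  proof (induction K arbitrary: G rule: finite_induct)
    case empty
    then show ?case by simp
  next
    case (insert k1 K G)
    have k01: "k0 \<notin> K" "k1 \<noteq> k0" using insert.prems(1) by auto
    have bG: "bounded_measurable N (G k)" if "k \<in> insert k0 (insert k1 K)" for k
      using insert.prems(2) that by blast
    have iG: "G k (T v x) = G k x" if "k \<in> insert k0 (insert k1 K)" "v $ a = k * v $ b" for k v x
      using insert.prems(3) that by blast
    \<comment> \<open>\<open>u\<close> lies in the hyperplane of slope \<open>k1\<close>:
      \<open>G k1\<close> does not change along its multiples and is the fixed vector against the
      moving products \<open>h j\<close>.\<close>
    define u :: "int ^ 'd" where "u = axis a k1 + axis b 1"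
    have u: "u $ a = k1" "u $ b = 1" using ab by (auto simp: u_def axis_def)
    define R where "R = (\<lambda>x. \<Prod>k\<in>K. G k x)"
    define h where "h j x = G k0 (T (j *s u) x) * R (T (j *s u) x)" for j x
    have bR: "bounded_measurable N R"
      unfolding R_def using bG by (intro bounded_measurable_prod) auto
    then obtain D where D: "\<bar>R x\<bar> \<le> D" for x unfolding bounded_measurable_def by blast
    obtain C where C: "\<bar>G k0 x\<bar> \<le> C" for x
      using bG[of k0] unfolding bounded_measurable_def by blast
    have C0: "0 \<le> C" and D0: "0 \<le> D" using C[of undefined] D[of undefined] by auto
    have "integral\<^sup>L N (\<lambda>x. G k1 x * (G k0 x * R x)) = 0"
    proof (rule asymptotically_orthogonal[where h = h and g = "G k1" and I = UNIV])
      show "bounded_measurable N (G k1)" using bG by simp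
      show "h j \<in> borel_measurable N" for j
        unfolding h_def using bounded_measurable_T bG bR
        by (intro bounded_measurable_measurable bounded_measurable_mult) auto
      show "\<bar>h j x\<bar> \<le> C * D" for j x
        unfolding h_def abs_mult using C D C0 by (intro mult_mono) auto
      show "integral\<^sup>L N (\<lambda>x. G k1 x * h j x) = integral\<^sup>L N (\<lambda>x. G k1 x * (G k0 x * R x))" for j
      proof -
        have "G k1 (T (j *s u) x) = G k1 x" for x
          using u by (intro iG) auto
        then have "integral\<^sup>L N (\<lambda>x. G k1 x * h j x)
            = integral\<^sup>L N (\<lambda>x. G k1 (T (j *s u) x) * (G k0 (T (j *s u) x) * R (T (j *s u) x)))"
          by (simp add: h_def)
        also have "\<dots> = integral\<^sup>L N (\<lambda>x. G k1 x * (G k0 x * R x))"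
          using bG bR
          by (intro expectation_T[where f = "\<lambda>x. G k1 x * (G k0 x * R x)"]
              bounded_measurable_measurable bounded_measurable_mult) auto
        finally show ?thesis .
      qed
      fix J :: "int set" and e :: real
      assume J: "finite J" and e: "0 < e"
      define n where "n = k1 - k0"
      have n: "n \<noteq> 0" using k01 by (simp add: n_def)
      obtain F' where F': "F' \<noteq> bot" "mixing_along N T F'" "\<forall>\<^sub>F v in F'. \<exists>w. v = n *s w"
        using mixing_along_multiples[OF mp_action_axioms F n, of "{}"] by auto
      \<comment> \<open>The added 1 covers \<open>D = 0\<close>.\<close>
      define e' where "e' = e / (D * D + 1)"
      have e': "0 < e'" "e' * (D * D) \<le> e"
      proof -
        have "0 < D * D + 1" using D0 by (simp add: add_nonneg_pos)
        then show "0 < e'" "e' * (D * D) \<le> e" using e D0 by (auto simp: e'_def field_simps)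
      qed
      have "\<forall>\<^sub>F v in F'. \<bar>integral\<^sup>L N (\<lambda>x. G k0 (T (i *s u) x) * G k0 (T v x))\<bar> < e'" for i
      proof -
        have "((\<lambda>v. integral\<^sup>L N (\<lambda>x. G k0 (T (i *s u) x) * G k0 (T v x)))
            \<longlongrightarrow> integral\<^sup>L N (\<lambda>x. G k0 (T (i *s u) x)) * integral\<^sup>L N (G k0)) F'"
          using bG by (intro mixing_along_integral F' bounded_measurable_T) auto
        then show ?thesis
          using tendstoD[OF _ e'(1)] insert.prems(4) by (fastforce simp: dist_real_def)
      qed
      then have "\<forall>\<^sub>F v in F'. \<forall>i\<in>J. \<bar>integral\<^sup>L N (\<lambda>x. G k0 (T (i *s u) x) * G k0 (T v x))\<bar> < e'"
        using J by (simp add: eventually_ball_finite)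
      with F'(3) have "\<forall>\<^sub>F v in F'. (\<exists>w. v = n *s w) \<and>
          (\<forall>i\<in>J. \<bar>integral\<^sup>L N (\<lambda>x. G k0 (T (i *s u) x) * G k0 (T v x))\<bar> < e')"
        by (rule eventually_conj)
      from eventually_happens'[OF F'(1) this] obtain w where
        w: "\<And>i. i \<in> J \<Longrightarrow> \<bar>integral\<^sup>L N (\<lambda>x. G k0 (T (i *s u) x) * G k0 (T (n *s w) x))\<bar> < e'"
        by blast
      \<comment> \<open>Solves for \<open>n *s w - j *s u\<close> to lie in the hyperplane of slope
        \<open>k0\<close>; since \<open>u\<close> has slope \<open>k1\<close>, this is possible
        because \<open>n\<close> is \<open>k1 - k0\<close>.\<close>
      define j where "j = w $ a - k0 * w $ b"
      have Gj: "G k0 (T (n *s w) x) = G k0 (T (j *s u) x)" for x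
      proof -
        have "G k0 (T ((n *s w - j *s u) + j *s u) x) = G k0 (T (j *s u) x)"
          unfolding T_add using u by (intro iG) (auto simp: j_def n_def algebra_simps)
        then show ?thesis by simp
      qed
      have "\<bar>integral\<^sup>L N (\<lambda>x. h i x * h j x)\<bar> \<le> e" if i: "i \<in> J" for i
      proof -
        define Q where "Q x = G k0 (T (i *s u) x) * G k0 (T (j *s u) x)" for x
        define m where "m = integral\<^sup>L N Q"
        \<comment> \<open>The induction hypothesis wants mean zero for the factor at
          \<open>k0\<close>, hence the centring by \<open>m\<close>. What remains is
          \<open>m\<close> times a bounded integral, and \<open>m\<close> is small by mixing.
          Products of two translates keep their direction of invariance because translations
          commute.\<close>
        define G' where "G' k x = (if k = k0 then Q x - m
            else G k (T (i *s u) x) * G k (T (j *s u) x))" for k x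
        have bQ: "bounded_measurable N Q"
          unfolding Q_def using bG by (intro bounded_measurable_mult bounded_measurable_T) auto
        have G'0: "G' k0 = (\<lambda>x. Q x - m)"
          by (simp add: G'_def fun_eq_iff)
        have G': "G' k = (\<lambda>x. G k (T (i *s u) x) * G k (T (j *s u) x))" if "k \<noteq> k0" for k
          using that by (simp add: G'_def fun_eq_iff)
        have bG': "bounded_measurable N (G' k)" if "k \<in> insert k0 K" for k
        proof (cases "k = k0")
          case True
          then show ?thesis
            using bounded_measurable_diff[OF bQ bounded_measurable_const] by (simp add: G'0)
        next
          case False
          then show ?thesis
            using that bounded_measurable_mult[OF bounded_measurable_T[OF bG] bounded_measurable_T[OF bG]]
            by (simp add: G')
        qed
        have "integral\<^sup>L N (\<lambda>x. G' k0 x * (\<Prod>k\<in>K. G' k x)) = 0"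
        proof (rule insert.IH[OF k01(1) bG'])
          fix k v x assume kv: "k \<in> insert k0 K" "v $ a = k * v $ b"
          have "G k (T w (T v x)) = G k (T w x)" for w
            unfolding T_comm[of w v] using kv by (intro iG) auto
          then show "G' k (T v x) = G' k x"
            by (cases "k = k0") (simp_all add: G'_def Q_def)
        next
          show "integral\<^sup>L N (G' k0) = 0"
            using integrable_bounded_measurable[OF bQ]
            by (simp add: G'0 m_def prob_space)
        qed
        moreover have "(\<Prod>k\<in>K. G' k x) = R (T (i *s u) x) * R (T (j *s u) x)" for x
          unfolding R_def prod.distrib[symmetric] using k01(1)
          by (intro prod.cong) (auto simp: G'_def)
        ultimately have *: "integral\<^sup>L N (\<lambda>x. (Q x - m) * (R (T (i *s u) x) * R (T (j *s u) x))) = 0"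
          by (simp add: G'_def)
        have bRR: "bounded_measurable N (\<lambda>x. R (T (i *s u) x) * R (T (j *s u) x))"
          using bR by (intro bounded_measurable_mult bounded_measurable_T)
        have "integral\<^sup>L N (\<lambda>x. Q x * (R (T (i *s u) x) * R (T (j *s u) x)))
            = m * integral\<^sup>L N (\<lambda>x. R (T (i *s u) x) * R (T (j *s u) x))"
          using * integrable_bounded_measurable[OF bRR]
            integrable_bounded_measurable[OF bounded_measurable_mult[OF bQ bRR]]
          by (simp add: left_diff_distrib)
        moreover have "integral\<^sup>L N (\<lambda>x. h i x * h j x)
            = integral\<^sup>L N (\<lambda>x. Q x * (R (T (i *s u) x) * R (T (j *s u) x)))"
          by (intro Bochner_Integration.integral_cong) (auto simp: h_def Q_def)
        moreover have "\<bar>integral\<^sup>L N (\<lambda>x. R (T (i *s u) x) * R (T (j *s u) x))\<bar> \<le> D * D"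
        proof -
          have "\<bar>integral\<^sup>L N (\<lambda>x. R (T (i *s u) x) * R (T (j *s u) x))\<bar>
              \<le> integral\<^sup>L N (\<lambda>x. \<bar>R (T (i *s u) x) * R (T (j *s u) x)\<bar>)"
            by (rule integral_abs_bound)
          also have "\<dots> \<le> integral\<^sup>L N (\<lambda>x. D * D)"
          proof (intro integral_mono)
            show "\<bar>R (T (i *s u) x) * R (T (j *s u) x)\<bar> \<le> D * D" for x
              unfolding abs_mult using D D0 by (intro mult_mono) auto
          qed (use integrable_bounded_measurable[OF bRR] in auto)
          finally show ?thesis by (simp add: prob_space)
        qed
        moreover have "\<bar>m\<bar> \<le> e'"
          using w[OF i] unfolding m_def Q_def Gj by simp
        ultimately have "\<bar>integral\<^sup>L N (\<lambda>x. h i x * h j x)\<bar> \<le> e' * (D * D)"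
          using e'(1) by (simp add: abs_mult mult_mono)
        then show ?thesis using e' by linarith
      qed
      then show "\<exists>j\<in>UNIV. \<forall>i\<in>J. \<bar>integral\<^sup>L N (\<lambda>x. h i x * h j x)\<bar> \<le> e" by blast
    qed
    then show ?case
      using insert.hyps by (simp add: R_def mult.left_commute)
  qed
qed

section \<open>Relabelling a random subset by shears\<close>

text \<open>Pullback along \<open>g\<close>, free of the \<open>inv\<close> in
  \<open>subset_action\<close>; composition is therefore reversed.\<close>

definition relabel :: "('a \<Rightarrow> 'a) \<Rightarrow> ('a \<Rightarrow> bool) \<Rightarrow> ('a \<Rightarrow> bool)" where
  "relabel g \<omega> = \<omega> \<circ> g"

text \<open>For finite \<open>S\<close> these events form a generating class stable under
  intersection, so their probabilities determine the measure.\<close>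

definition containing :: "'a set \<Rightarrow> ('a \<Rightarrow> bool) set" where
  "containing S = {\<omega>. \<forall>t\<in>S. \<omega> t}"

text \<open>When \<open>u $ b = 0\<close>, level \<open>i\<close> stays fixed pointwise and every
  other level is translated within itself. With \<open>u\<close> along \<open>a\<close> it tilts
  invariance hyperplanes; with \<open>u\<close> inside a hyperplane it separates parallel
  levels.\<close>

definition shear :: "'d \<Rightarrow> int \<Rightarrow> int ^ 'd \<Rightarrow> int ^ 'd \<Rightarrow> int ^ 'd" where
  "shear b i u t = t + (t $ b - i) *s u"

lemma relabel_comp: "relabel (g \<circ> h) \<omega> = relabel h (relabel g \<omega>)"
  by (simp add: relabel_def comp_assoc)

lemma relabel_vimage_containing: "relabel g -` containing S = containing (g ` S)"
  by (auto simp: relabel_def containing_def)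

lemma containing_empty [simp]: "containing {} = UNIV"
  by (simp add: containing_def)

lemma containing_Un: "containing (S \<union> S') = containing S \<inter> containing S'"
  by (auto simp: containing_def)

lemma shear_coord: "u $ b = 0 \<Longrightarrow> shear b i u t $ b = t $ b"
  by (simp add: shear_def)

lemma shear_add:
  "u $ b = 0 \<Longrightarrow> shear b i (u + w) = shear b i w \<circ> shear b i u"
  by (rule ext) (simp add: shear_def vec_eq_iff algebra_simps)

lemma shear_zero: "shear b i 0 = id"
  by (rule ext) (simp add: shear_def)

lemma shear_fixes: "t $ b = i \<Longrightarrow> shear b i u t = t"
  by (simp add: shear_def)

lemma det_transvection:
  assumes "c \<noteq> b"
  shows "det (\<chi> k. if k = c then row c (mat 1) + j *s row b (mat 1) else row k (mat 1)
    :: 'a::comm_ring_1 ^ 'd ^ 'd) = 1"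
  using det_row_operation[OF assms, of "mat 1" j] by simp

text \<open>The linear part is an elementary row operation on the identity, hence of determinant 1;
  the base level \<open>i\<close> contributes a constant translation.\<close>

lemma shear_axis_ASL:
  fixes b :: "'d::finite"
  assumes "c \<noteq> b"
  shows "shear b i (axis c j) \<in> ASL"
proof -
  define A :: "int ^ 'd ^ 'd"
    where "A = (\<chi> k. if k = c then row c (mat 1) + j *s row b (mat 1) else row k (mat 1))"
  have "shear b i (axis c j) = (\<lambda>t. A *v t + (- i) *s axis c j)"
  proof (intro ext)
    fix t :: "int ^ 'd"
    have "(A *v t) $ k = t $ k + (if k = c then j * t $ b else 0)" for k
    proof -
      have one: "(\<Sum>l\<in>UNIV. (if m = l then 1 else 0) * t $ l) = t $ m" for m
        by (subst if_distrib[where f = "\<lambda>x. x * _"]) (simp add: sum.delta' cong: if_cong)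
      show ?thesis
      proof (cases "k = c")
        case True
        have "(A *v t) $ k = (\<Sum>l\<in>UNIV. (if c = l then 1 else 0) * t $ l
            + j * ((if b = l then 1 else 0) * t $ l))"
          using True by (simp add: A_def matrix_vector_mult_def row_def mat_def distrib_right mult.assoc)
        also have "\<dots> = t $ c + j * t $ b"
          by (simp only: sum.distrib sum_distrib_left[symmetric] one)
        finally show ?thesis using True by simp
      next
        case False
        then have "(A *v t) $ k = (\<Sum>l\<in>UNIV. (if k = l then 1 else 0) * t $ l)"
          by (simp add: A_def matrix_vector_mult_def row_def mat_def)
        then show ?thesis using one False by simp
      qed
    qed
    then show "shear b i (axis c j) t = A *v t + (- i) *s axis c j"
      by (simp add: vec_eq_iff shear_def axis_def algebra_simps)
  qed
  moreover have "det A = 1" unfolding A_def by (rule det_transvection[OF assms])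
  ultimately show ?thesis unfolding ASL_def by blast
qed

lemma translation_ASL: "(\<lambda>t. t + v) \<in> ASL"
proof -
  have "(\<lambda>t. t + v) = (\<lambda>t. mat 1 *v t + v)" by simp
  then show ?thesis unfolding ASL_def using det_I by blast
qed

lemma sets_containing:
  "sets (borel :: ('i::countable \<Rightarrow> bool) measure) = sigma_sets UNIV {containing S | S. finite S}"
    (is "_ = sigma_sets UNIV ?E")
proof -
  have "sets (borel :: ('i \<Rightarrow> bool) measure)
      = sigma_sets UNIV {{f. f i \<in> A} | i A. True}" (is "_ = sigma_sets UNIV ?C")
    unfolding sets_borel_fun_bool sets_PiM_single by simp
  also have "\<dots> = sigma_sets UNIV ?E"
  proof (rule sigma_sets_eqI)
    fix X assume "X \<in> ?C"
    then obtain i A where X: "X = {f :: 'i \<Rightarrow> bool. f i \<in> A}" by blast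
    have c: "containing {i} \<in> sigma_sets UNIV ?E" by (intro sigma_sets.Basic) blast
    then have c': "UNIV - containing {i} \<in> sigma_sets UNIV ?E" by (rule sigma_sets.Compl)
    have e: "{} \<in> sigma_sets UNIV ?E" by (rule sigma_sets.Empty)
    then have u: "UNIV - {} \<in> sigma_sets UNIV ?E" by (rule sigma_sets.Compl)
    \<comment> \<open>A set of truth values is one of four, and each case is expressed by occupation
      of the site \<open>i\<close> or its complement.\<close>
    have "X = (if True \<in> A then (if False \<in> A then UNIV else containing {i})
        else (if False \<in> A then UNIV - containing {i} else {}))"
      unfolding X containing_def by (auto; metis (full_types))
    then show "X \<in> sigma_sets UNIV ?E" using c c' e u by auto
  next
    fix X assume "X \<in> ?E"
    then obtain S where S: "X = containing S" "finite S" by blast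
    interpret sigma_algebra UNIV "sigma_sets UNIV ?C" by (rule sigma_algebra_sigma_sets) auto
    show "X \<in> sigma_sets UNIV ?C"
      unfolding S(1) using S(2)
    proof (induction S rule: finite_induct)
      case empty
      show ?case using top by simp
    next
      case (insert i S)
      have "{f. f i \<in> {True}} \<in> sigma_sets UNIV ?C" by (intro sigma_sets.Basic) blast
      then have "{f. f i \<in> {True}} \<inter> containing S \<in> sigma_sets UNIV ?C"
        using insert.IH by (rule Int)
      moreover have "containing (insert i S) = {f. f i \<in> {True}} \<inter> containing S"
        by (auto simp: containing_def)
      ultimately show ?case by (simp only:)
    qed
  qed
  finally show ?thesis .
qed

section \<open>The process and its symmetries\<close>

locale asl_process = prob_space \<mu> for \<mu> :: "(int ^ 'd \<Rightarrow> bool) measure" +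
  assumes sets_borel: "sets \<mu> = sets borel"
    and ASL_invariant: "invariant_measure ASL subset_action \<mu>"
    and translations_wm: "weakly_mixing_action translation_group subset_action \<mu>"
begin

lemma space_process: "space \<mu> = UNIV"
  using sets_eq_imp_space_eq[OF sets_borel] by simp

definition preserving :: "(int ^ 'd \<Rightarrow> int ^ 'd) \<Rightarrow> bool" where
  "preserving g \<longleftrightarrow> relabel g \<in> measurable \<mu> \<mu> \<and> distr \<mu> \<mu> (relabel g) = \<mu>"

lemma preserving_inverse_ASL:
  assumes "h \<in> ASL" "g \<circ> h = id" "h \<circ> g = id"
  shows "preserving g"
proof -
  have "subset_action h = relabel g"
    using inv_unique_comp[OF assms(3,2)] by (simp add: fun_eq_iff subset_action_def relabel_def)
  then show ?thesis
    using ASL_invariant assms(1) unfolding invariant_measure_def preserving_def by metis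
qed

lemma preserving_comp:
  assumes "preserving g" "preserving h"
  shows "preserving (g \<circ> h)"
proof -
  have m: "relabel g \<in> measurable \<mu> \<mu>" "relabel h \<in> measurable \<mu> \<mu>"
    using assms by (auto simp: preserving_def)
  have eq: "relabel (g \<circ> h) = relabel h \<circ> relabel g"
    by (simp add: fun_eq_iff relabel_def)
  have "distr \<mu> \<mu> (relabel (g \<circ> h)) = distr (distr \<mu> \<mu> (relabel g)) \<mu> (relabel h)"
    unfolding eq using m by (simp add: distr_distr)
  then show ?thesis
    using assms m unfolding preserving_def eq by (auto intro: measurable_comp)
qed

text \<open>Shears with common \<open>b\<close> and \<open>i\<close> compose by adding their
  vectors. Splitting \<open>u\<close> into its axis components, none of them along \<open>b\<close>,
  reduces the claim to transvections.\<close>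

lemma preserving_shear:
  assumes "u $ b = 0"
  shows "preserving (shear b i u)"
proof -
  have axis: "preserving (shear b i (axis c j))" if "c \<noteq> b" for c j
  proof (rule preserving_inverse_ASL)
    have z: "axis c k $ b = 0" for k :: int using that by (simp add: axis_def)
    have "axis c j + axis c (- j) = 0" "axis c (- j) + axis c j = 0"
      by (auto simp: vec_eq_iff axis_def)
    then show "shear b i (axis c j) \<circ> shear b i (axis c (- j)) = id"
      "shear b i (axis c (- j)) \<circ> shear b i (axis c j) = id"
      by (simp_all add: shear_add[OF z, symmetric] shear_zero)
  qed (rule shear_axis_ASL[OF that])
  have "preserving (shear b i (\<Sum>c\<in>C. axis c (u $ c)))" if "finite C" "b \<notin> C" for C
    using that
  proof (induction C rule: finite_induct)
    case empty
    have "preserving id"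
      using translation_ASL[of 0] by (intro preserving_inverse_ASL[of id]) (auto simp: id_def)
    then show ?case by (simp add: shear_zero id_def)
  next
    case (insert c C)
    have "axis c (u $ c) $ b = 0" using insert.prems by (simp add: axis_def)
    from shear_add[OF this] have "shear b i (\<Sum>c\<in>insert c C. axis c (u $ c))
        = shear b i (\<Sum>c\<in>C. axis c (u $ c)) \<circ> shear b i (axis c (u $ c))"
      using insert.hyps by simp
    moreover have "b \<notin> C" "c \<noteq> b" using insert.prems by auto
    ultimately show ?case
      using preserving_comp[OF insert.IH axis] by presburger
  qed
  from this[of "UNIV - {b}"] have "preserving (shear b i (\<Sum>c\<in>UNIV - {b}. axis c (u $ c)))"
    by simp
  moreover have "(\<Sum>c\<in>UNIV - {b}. axis c (u $ c)) = u"
  proof (simp only: vec_eq_iff sum_component, intro allI)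
    fix k
    have "(\<Sum>c\<in>UNIV - {b}. axis c (u $ c) $ k) = (\<Sum>c\<in>UNIV - {b}. if c = k then u $ k else 0)"
      by (intro sum.cong) (auto simp: axis_def)
    then show "(\<Sum>c\<in>UNIV - {b}. axis c (u $ c) $ k) = u $ k"
      using assms by (simp add: sum.delta)
  qed
  ultimately show ?thesis by simp
qed

definition translate :: "int ^ 'd \<Rightarrow> (int ^ 'd \<Rightarrow> bool) \<Rightarrow> (int ^ 'd \<Rightarrow> bool)" where
  "translate v = relabel (\<lambda>t. t + v)"

lemma preserving_translation: "preserving (\<lambda>t. t + v)"
  using translation_ASL[of "- v"] by (rule preserving_inverse_ASL) (auto simp: fun_eq_iff)

sublocale mp_action \<mu> translate
proof
  show "translate v \<in> measurable \<mu> \<mu>" "distr \<mu> \<mu> (translate v) = \<mu>" for v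
    using preserving_translation[of v] unfolding preserving_def translate_def by auto
  show "translate 0 \<omega> = \<omega>" "translate (v + w) \<omega> = translate v (translate w \<omega>)" for v w \<omega>
    by (auto simp: translate_def relabel_def fun_eq_iff add.assoc add.commute[of w v])
qed (rule space_process)

lemma pair_preserving:
  assumes "preserving g"
  shows "map_prod (relabel g) (relabel g) \<in> measurable (\<mu> \<Otimes>\<^sub>M \<mu>) (\<mu> \<Otimes>\<^sub>M \<mu>)"
    and "distr (\<mu> \<Otimes>\<^sub>M \<mu>) (\<mu> \<Otimes>\<^sub>M \<mu>) (map_prod (relabel g) (relabel g)) = \<mu> \<Otimes>\<^sub>M \<mu>"
proof -
  have sfM: "sigma_finite_measure \<mu>" by unfold_locales
  have [measurable]: "relabel g \<in> measurable \<mu> \<mu>" and d: "distr \<mu> \<mu> (relabel g) = \<mu>"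
    using assms by (auto simp: preserving_def)
  show "map_prod (relabel g) (relabel g) \<in> measurable (\<mu> \<Otimes>\<^sub>M \<mu>) (\<mu> \<Otimes>\<^sub>M \<mu>)"
    unfolding map_prod_def by measurable
  show "distr (\<mu> \<Otimes>\<^sub>M \<mu>) (\<mu> \<Otimes>\<^sub>M \<mu>) (map_prod (relabel g) (relabel g)) = \<mu> \<Otimes>\<^sub>M \<mu>"
    using pair_measure_distr[of "relabel g" \<mu> \<mu> "relabel g" \<mu> \<mu>, unfolded d, OF _ _ sfM]
    by (simp add: map_prod_def)
qed

lemma containing_sets: "finite S \<Longrightarrow> containing S \<in> sets \<mu>"
  unfolding sets_borel sets_containing by (intro sigma_sets.Basic) blast

lemma translation_mixing_filter:
  "\<exists>F. F \<noteq> bot \<and> mixing_along \<mu> translate F"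
proof -
  have "\<exists>F. F \<noteq> bot \<and> mixing_along \<mu> translate F \<and> (\<forall>\<^sub>F v in F. v \<in> UNIV)"
  proof (rule mixing_filter_exists)
    fix A assume A: "A \<in> sets (\<mu> \<Otimes>\<^sub>M \<mu>)"
      and inv: "\<And>v. v \<in> UNIV \<Longrightarrow> map_prod (translate v) (translate v) -` A = A"
    \<comment> \<open>Moving a subset by \<open>v\<close> pulls its indicator back by
      \<open>- v\<close>; the sign is harmless as invariance is assumed for all
      \<open>v\<close>.\<close>
    have "subset_action (\<lambda>t. t + v) = translate (- v)" for v :: "int ^ 'd"
    proof -
      have "inv (\<lambda>t. t + v) = (\<lambda>t. t + (- v))"
        by (rule inv_unique_comp) (auto simp: fun_eq_iff)
      then show ?thesis by (simp add: fun_eq_iff subset_action_def translate_def relabel_def)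
    qed
    note action = this
    have "map_prod (subset_action g) (subset_action g) -` A \<inter> space (\<mu> \<Otimes>\<^sub>M \<mu>) = A"
      if g: "g \<in> translation_group" for g
    proof -
      obtain v where "g = (\<lambda>t. t + v)" using g unfolding translation_group_def by blast
      then have "subset_action g = translate (- v)" using action by simp
      then show ?thesis using inv[of "- v"] by (simp add: space_pair_measure space_process)
    qed
    then show "measure (\<mu> \<Otimes>\<^sub>M \<mu>) A = 0 \<or> measure (\<mu> \<Otimes>\<^sub>M \<mu>) A = 1"
      by (intro translations_wm[unfolded weakly_mixing_action_def ergodic_action_def, rule_format, OF A])
  qed auto
  then show ?thesis by blast
qed

end

section \<open>Ergodicity of hyperplanes of translations\<close>

context asl_process
begin

abbreviation double :: "(int ^ 'd \<Rightarrow> int ^ 'd) \<Rightarrow> (int ^ 'd \<Rightarrow> bool) \<times> (int ^ 'd \<Rightarrow> bool)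
    \<Rightarrow> (int ^ 'd \<Rightarrow> bool) \<times> (int ^ 'd \<Rightarrow> bool)" where
  "double g \<equiv> map_prod (relabel g) (relabel g)"

abbreviation containing2 :: "(int ^ 'd) set \<Rightarrow> (int ^ 'd) set
    \<Rightarrow> ((int ^ 'd \<Rightarrow> bool) \<times> (int ^ 'd \<Rightarrow> bool)) set" where
  "containing2 S S' \<equiv> containing S \<times> containing S'"

lemma double_containing2:
  "double g z \<in> containing2 S S' \<longleftrightarrow> z \<in> containing2 (g ` S) (g ` S')"
  by (cases z) (auto simp: relabel_vimage_containing[symmetric])

text \<open>The shears \<open>t \<mapsto> t + j (t\<^sub>b - i) e\<^sub>a\<close> fix the points at height \<open>i\<close> and tilt the invariance
  hyperplane of each factor. For a given shear, all but finitely many others give tilted families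
  without a common direction, and then the sheared products are orthogonal by the induction
  hypothesis at fewer heights.\<close>

lemma containing2_invariant_uncorrelated:
  fixes G :: "int \<Rightarrow> (int ^ 'd \<Rightarrow> bool) \<times> (int ^ 'd \<Rightarrow> bool) \<Rightarrow> real"
  assumes ab: "a \<noteq> b" and "finite S" "finite S'" "finite K" "K \<noteq> {}"
    and "\<And>k. k \<in> K \<Longrightarrow> bounded_measurable (\<mu> \<Otimes>\<^sub>M \<mu>) (G k)"
    and "\<And>k v z. k \<in> K \<Longrightarrow> v $ a = k * v $ b \<Longrightarrow> G k (map_prod (translate v) (translate v) z) = G k z"
    and "\<And>k. k \<in> K \<Longrightarrow> integral\<^sup>L (\<mu> \<Otimes>\<^sub>M \<mu>) (G k) = 0"
  shows "integral\<^sup>L (\<mu> \<Otimes>\<^sub>M \<mu>) (\<lambda>z. indicator (containing2 S S') z * (\<Prod>k\<in>K. G k z)) = 0"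
proof -
  let ?N = "\<mu> \<Otimes>\<^sub>M \<mu>"
  interpret P: mp_action ?N "\<lambda>v. map_prod (translate v) (translate v)" by (rule mp_action_pair)
  have c2: "containing2 S S' \<in> sets ?N" if "finite S" "finite S'" for S S'
    using that by (intro pair_measureI containing_sets)
  note bi = bounded_measurable_indicator[OF c2]
  show ?thesis
    using assms(2-)
  proof (induction "card ((\<lambda>t. t $ b) ` (S \<union> S'))" arbitrary: S S' K G rule: less_induct)
    case less
    note fin = less.prems(1,2) and K = less.prems(3,4)
      and bG = less.prems(5) and iG = less.prems(6) and mG = less.prems(7)
    show ?case
    proof (cases "S \<union> S' = {}")
      case True
      obtain k0 where k0: "k0 \<in> K" using K by blast
      obtain F where F: "F \<noteq> bot" "mixing_along \<mu> translate F"
        using translation_mixing_filter by blast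
      \<comment> \<open>No sites remain and the indicator is 1. The slopes in \<open>K\<close> are
        distinct, so one factor of mean zero annihilates the product.\<close>
      have "integral\<^sup>L ?N (\<lambda>z. G k0 z * (\<Prod>k\<in>K - {k0}. G k z)) = 0"
        using K k0 bG iG mG
        by (intro invariant_directions_uncorrelated[OF P.mp_action_axioms F(1) mixing_along_pair[OF F(2)] ab])
          auto
      then show ?thesis using True K k0 by (simp add: prod.remove[OF K(1) k0])
    next
      case False
      then obtain i where i: "i \<in> (\<lambda>t. t $ b) ` (S \<union> S')" by blast
      define f where "f S = {t\<in>S. t $ b = i}" for S :: "(int ^ 'd) set"
      define r where "r S = {t\<in>S. t $ b \<noteq> i}" for S :: "(int ^ 'd) set"
      have fr: "S = f S \<union> r S" for S by (auto simp: f_def r_def)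
      have fin_fr: "finite (f S)" "finite (r S)" "finite (f S')" "finite (r S')"
        using fin by (auto simp: f_def r_def)
      define sh where "sh j = shear b i (axis a j)" for j :: int
      have ax: "axis a j $ b = 0" for j :: int using ab by (simp add: axis_def)
      have pres: "double (sh j) \<in> measurable ?N ?N" "distr ?N ?N (double (sh j)) = ?N" for j
        unfolding sh_def by (rule pair_preserving[OF preserving_shear[OF ax]])+
      have shb: "sh j t $ b = t $ b" for j t unfolding sh_def by (rule shear_coord[OF ax])
      have sh_f: "sh j ` f S = f S" for j S
        by (force simp: sh_def f_def shear_fixes image_iff)
      have exp_sh: "integral\<^sup>L ?N (\<lambda>z. p (double (sh j) z)) = integral\<^sup>L ?N p"
        if "p \<in> borel_measurable ?N" for p :: "_ \<Rightarrow> real" and j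
        using integral_distr[OF pres(1) that, of j] by (simp add: pres(2))
      have b_sh: "bounded_measurable ?N (\<lambda>z. p (double (sh j) z))"
        if "bounded_measurable ?N p" for p j
        using bounded_measurable_comp[OF that pres(1)] .
      have b_prod: "bounded_measurable ?N (\<lambda>z. \<Prod>k\<in>K. G k z)"
        using bG by (intro bounded_measurable_prod) auto
      define q where "q z = indicator (containing2 (r S) (r S')) z * (\<Prod>k\<in>K. G k z)" for z
      have bq: "bounded_measurable ?N q"
        unfolding q_def using bi fin_fr b_prod by (intro bounded_measurable_mult) auto
      then obtain C where C: "\<bar>q z\<bar> \<le> C" for z unfolding bounded_measurable_def by blast
      have translate_sh: "double (sh j) (map_prod (translate v) (translate v) z)
          = map_prod (translate w) (translate w) (double (sh j) z)"
        if "w = v - v $ b *s axis a j" for j v w z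
      proof -
        have "relabel (sh j) (translate v \<omega>) = translate w (relabel (sh j) \<omega>)" for \<omega>
        proof -
          have "(\<lambda>t. t + v) \<circ> sh j = sh j \<circ> (\<lambda>t. t + w)"
            using ab by (simp add: fun_eq_iff sh_def shear_def that vec_eq_iff axis_def algebra_simps)
          then show ?thesis
            unfolding translate_def by (metis relabel_comp)
        qed
        then show ?thesis by (cases z) simp
      qed
      \<comment> \<open>Conjugating translation by \<open>v\<close> with \<open>sh j\<close> gives
        translation by \<open>v - v $ b *s axis a j\<close>, so the slope \<open>k\<close> becomes
        \<open>k + j\<close>.\<close>
      have tilt: "G k (double (sh j) (map_prod (translate v) (translate v) z)) = G k (double (sh j) z)"
        if "k \<in> K" "v $ a = (k + j) * v $ b" for k j v z
        unfolding translate_sh[OF refl]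
        using that ab by (intro iG) (auto simp: axis_def algebra_simps)
      have "integral\<^sup>L ?N (\<lambda>z. indicator (containing2 (f S) (f S')) z * q z) = 0"
      proof (rule P.asymptotically_orthogonal[where h = "\<lambda>j z. q (double (sh j) z)"
            and g = "indicator (containing2 (f S) (f S'))" and I = UNIV and C = C])
        show "bounded_measurable ?N (indicator (containing2 (f S) (f S')))"
          using bi fin_fr by simp
        show "(\<lambda>z. q (double (sh j) z)) \<in> borel_measurable ?N" for j
          using b_sh[OF bq] by (rule bounded_measurable_measurable)
        show "\<bar>q (double (sh j) z)\<bar> \<le> C" for j z by (rule C)
        show "integral\<^sup>L ?N (\<lambda>z. indicator (containing2 (f S) (f S')) z * q (double (sh j) z))
            = integral\<^sup>L ?N (\<lambda>z. indicator (containing2 (f S) (f S')) z * q z)" for j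
        proof -
          have "indicator (containing2 (f S) (f S')) (double (sh j) z)
              = (indicator (containing2 (f S) (f S')) z :: real)" for z
            using double_containing2[of "sh j" z "f S" "f S'"] by (simp add: sh_f indicator_def)
          then have "integral\<^sup>L ?N (\<lambda>z. indicator (containing2 (f S) (f S')) z * q (double (sh j) z))
              = integral\<^sup>L ?N (\<lambda>z. indicator (containing2 (f S) (f S')) (double (sh j) z)
                  * q (double (sh j) z))" by simp
          also have "\<dots> = integral\<^sup>L ?N (\<lambda>z. indicator (containing2 (f S) (f S')) z * q z)"
            using bi fin_fr bq
            by (intro exp_sh[of "\<lambda>z. indicator (containing2 (f S) (f S')) z * q z"]
                bounded_measurable_measurable bounded_measurable_mult) auto
          finally show ?thesis .
        qed
        fix J :: "int set" and e :: real
        assume J: "finite J" and e: "0 < e"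
        \<comment> \<open>The values of \<open>j\<close> for which some slope in
          \<open>K + j\<close> meets one in \<open>K + l\<close>, \<open>l\<close> in
          \<open>J\<close>.\<close>
        define bad where "bad = (\<lambda>(l, k, k'). l + k - k') ` (J \<times> K \<times> K)"
        have "finite bad" unfolding bad_def using J K by auto
        then obtain j where j: "j \<notin> bad" using ex_new_if_finite infinite_UNIV_int by blast
        have "integral\<^sup>L ?N (\<lambda>z. q (double (sh l) z) * q (double (sh j) z)) = 0" if l: "l \<in> J" for l
        proof -
          let ?R = "sh l ` r S \<union> sh j ` r S" and ?R' = "sh l ` r S' \<union> sh j ` r S'"
          define K' where "K' = (\<lambda>k. k + l) ` K \<union> (\<lambda>k. k + j) ` K"
          have disj: "(\<lambda>k. k + l) ` K \<inter> (\<lambda>k. k + j) ` K = {}"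
          proof (rule ccontr)
            assume "\<not> ?thesis"
            then obtain k k' where kk: "k \<in> K" "k' \<in> K" "k + l = k' + j" by auto
            then have "j = l + k - k'" by simp
            then have "j \<in> bad" unfolding bad_def using kk l by force
            then show False using j by simp
          qed
          \<comment> \<open>Both sheared families merged into one indexed by slope; by
            \<open>disj\<close> each slope in \<open>K'\<close> comes from exactly one of
            them.\<close>
          define G' where "G' k z = (if k - l \<in> K then G (k - l) (double (sh l) z)
              else G (k - j) (double (sh j) z))" for k z
          have K'_cases: "(k - l \<in> K) \<or> (k - l \<notin> K \<and> k - j \<in> K)" if "k \<in> K'" for k
            using that unfolding K'_def by auto
          have G'l: "G' k = (\<lambda>z. G (k - l) (double (sh l) z))" if "k - l \<in> K" for k
            using that by (simp add: G'_def fun_eq_iff)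
          have G'j: "G' k = (\<lambda>z. G (k - j) (double (sh j) z))" if "k - l \<notin> K" for k
            using that by (simp add: G'_def fun_eq_iff)
          have "integral\<^sup>L ?N (\<lambda>z. indicator (containing2 ?R ?R') z * (\<Prod>k\<in>K'. G' k z)) = 0"
          proof (rule less.hyps)
            \<comment> \<open>Shearing along \<open>a\<close> keeps heights, and the sites at height
              \<open>i\<close> went into the fixed factor, so at least one height has
              disappeared.\<close>
            have "(\<lambda>t. t $ b) ` (?R \<union> ?R') \<subseteq> (\<lambda>t. t $ b) ` (S \<union> S') - {i}"
              by (auto simp: shb r_def)
            then have "card ((\<lambda>t. t $ b) ` (?R \<union> ?R')) \<le> card ((\<lambda>t. t $ b) ` (S \<union> S') - {i})"
              using fin by (intro card_mono) auto
            also have "\<dots> < card ((\<lambda>t. t $ b) ` (S \<union> S'))"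
              using fin i by (intro card_Diff1_less) auto
            finally show "card ((\<lambda>t. t $ b) ` (?R \<union> ?R')) < card ((\<lambda>t. t $ b) ` (S \<union> S'))" .
            show "finite ?R" "finite ?R'" using fin_fr by auto
            show "finite K'" "K' \<noteq> {}" using K by (auto simp: K'_def)
            fix k assume k: "k \<in> K'"
            show "bounded_measurable ?N (G' k)"
              using K'_cases[OF k] by (auto simp: G'l G'j intro!: b_sh bG)
            show "integral\<^sup>L ?N (G' k) = 0"
              using K'_cases[OF k] exp_sh[OF bounded_measurable_measurable[OF bG]] mG
              by (auto simp: G'l G'j)
            fix v :: "int ^ 'd" and z assume v: "v $ a = k * v $ b"
            show "G' k (map_prod (translate v) (translate v) z) = G' k z"
              using K'_cases[OF k]
            proof (elim disjE conjE)
              assume kl: "k - l \<in> K"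
              show ?thesis unfolding G'l[OF kl] using v by (intro tilt[OF kl]) simp
            next
              assume kl: "k - l \<notin> K" and kj: "k - j \<in> K"
              show ?thesis unfolding G'j[OF kl] using v by (intro tilt[OF kj]) simp
            qed
          qed
          moreover have "q (double (sh l) z) * q (double (sh j) z)
              = indicator (containing2 ?R ?R') z * (\<Prod>k\<in>K'. G' k z)" for z
          proof -
            have "(\<Prod>k\<in>K'. G' k z)
                = (\<Prod>k\<in>(\<lambda>k. k + l) ` K. G' k z) * (\<Prod>k\<in>(\<lambda>k. k + j) ` K. G' k z)"
              unfolding K'_def using K disj by (intro prod.union_disjoint) auto
            also have "(\<Prod>k\<in>(\<lambda>k. k + l) ` K. G' k z) = (\<Prod>k\<in>K. G k (double (sh l) z))"
              by (subst prod.reindex) (auto simp: G'_def intro!: prod.cong)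
            also have "(\<Prod>k\<in>(\<lambda>k. k + j) ` K. G' k z) = (\<Prod>k\<in>K. G k (double (sh j) z))"
            proof (subst prod.reindex)
              have "k + j - l \<notin> K" if "k \<in> K" for k
              proof
                assume "k + j - l \<in> K"
                then have "k + j \<in> (\<lambda>k. k + l) ` K" by (intro image_eqI[of _ _ "k + j - l"]) auto
                then show False using disj that by blast
              qed
              then show "prod ((\<lambda>k. G' k z) \<circ> (\<lambda>k. k + j)) K = (\<Prod>k\<in>K. G k (double (sh j) z))"
                by (intro prod.cong) (auto simp: G'_def)
            qed auto
            finally have p: "(\<Prod>k\<in>K'. G' k z)
                = (\<Prod>k\<in>K. G k (double (sh l) z)) * (\<Prod>k\<in>K. G k (double (sh j) z))" .
            have "indicator (containing2 ?R ?R') z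
                = (indicator (containing2 (r S) (r S')) (double (sh l) z)
                  * indicator (containing2 (r S) (r S')) (double (sh j) z) :: real)"
              using double_containing2[of "sh l" z "r S" "r S'"] double_containing2[of "sh j" z "r S" "r S'"]
              by (cases z) (auto simp: indicator_def containing_Un)
            then show ?thesis by (simp add: q_def p mult_ac)
          qed
          ultimately show ?thesis by simp
        qed
        then show "\<exists>j\<in>UNIV. \<forall>l\<in>J. \<bar>integral\<^sup>L ?N (\<lambda>z. q (double (sh l) z) * q (double (sh j) z))\<bar> \<le> e"
          using e by (intro bexI[of _ j]) auto
      qed
      moreover have "indicator (containing2 S S') z * (\<Prod>k\<in>K. G k z)
          = indicator (containing2 (f S) (f S')) z * q z" for z
      proof -
        have "containing2 S S' = containing2 (f S) (f S') \<inter> containing2 (r S) (r S')"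
          using fr[of S] fr[of S'] by (metis Times_Int_Times containing_Un)
        then show ?thesis by (simp add: q_def indicator_inter_arith mult.assoc)
      qed
      ultimately show ?thesis by simp
    qed
  qed
qed

lemma sets_pair_containing:
  "sets (\<mu> \<Otimes>\<^sub>M \<mu>) = sigma_sets UNIV {containing2 S S' | S S'. finite S \<and> finite S'}"
proof -
  let ?E = "{containing S | S. finite S} :: (int ^ 'd \<Rightarrow> bool) set set"
  have "sets (\<mu> \<Otimes>\<^sub>M \<mu>) = sets (sigma (space \<mu> \<times> space \<mu>) {a \<times> b | a b. a \<in> ?E \<and> b \<in> ?E})"
  proof (rule sets_pair_eq)
    have "UNIV \<in> ?E" using containing_empty[symmetric] by blast
    then show "{UNIV} \<subseteq> ?E" "{UNIV} \<subseteq> ?E" by auto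
  qed (auto simp: space_process sets_borel sets_containing)
  also have "\<dots> = sigma_sets UNIV {a \<times> b | a b. a \<in> ?E \<and> b \<in> ?E}"
    by (simp add: space_process)
  also have "{a \<times> b | a b. a \<in> ?E \<and> b \<in> ?E} = {containing2 S S' | S S'. finite S \<and> finite S'}"
    by auto
  finally show ?thesis .
qed

text \<open>The centred indicator of \<open>A\<close> is invariant under the hyperplane of slope 0
  and thus uncorrelated with all cylinders. Hence \<open>A\<close> is independent of every event,
  including itself.\<close>

lemma hyperplane_ergodic:
  assumes ab: "a \<noteq> b" and A: "A \<in> sets (\<mu> \<Otimes>\<^sub>M \<mu>)"
    and inv: "\<And>v. v $ a = 0 \<Longrightarrow> map_prod (translate v) (translate v) -` A = A"
  shows "measure (\<mu> \<Otimes>\<^sub>M \<mu>) A = 0 \<or> measure (\<mu> \<Otimes>\<^sub>M \<mu>) A = 1"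
proof -
  let ?N = "\<mu> \<Otimes>\<^sub>M \<mu>" and ?E = "{containing2 S S' | S S'. finite S \<and> finite S'}"
  interpret P: mp_action ?N "\<lambda>v. map_prod (translate v) (translate v)" by (rule mp_action_pair)
  have sp: "space ?N = UNIV" by (simp add: space_pair_measure space_process)
  have PU: "P.prob UNIV = 1" using P.prob_space by (simp only: sp)
  have iA: "integrable ?N (indicator B :: _ \<Rightarrow> real)" if "B \<in> sets ?N" for B
    using that by (intro P.integrable_bounded_measurable bounded_measurable_indicator)
  have indep: "P.prob (A \<inter> B) = P.prob A * P.prob B" if BE: "B \<in> ?E" for B
  proof -
    obtain S S' where B: "B = containing2 S S'" "finite S" "finite S'" using BE by blast
    have Bs: "B \<in> sets ?N" unfolding B using B by (intro pair_measureI containing_sets)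
    define G where "G = (\<lambda>(k::int) z. indicator A z - P.prob A)"
    have "integral\<^sup>L ?N (\<lambda>z. indicator (containing2 S S') z * (\<Prod>k\<in>{0}. G k z)) = 0"
    proof (rule containing2_invariant_uncorrelated[OF ab])
      fix k :: int assume "k \<in> {0}"
      show "bounded_measurable ?N (G k)"
        unfolding G_def using A
        by (intro bounded_measurable_diff bounded_measurable_indicator bounded_measurable_const)
      show "integral\<^sup>L ?N (G k) = 0"
        unfolding G_def using iA[OF A] by (simp add: PU sp)
      fix v :: "int ^ 'd" and z assume "v $ a = k * v $ b"
      then have "map_prod (translate v) (translate v) -` A = A" using \<open>k \<in> {0}\<close> inv by simp
      then have "map_prod (translate v) (translate v) z \<in> A \<longleftrightarrow> z \<in> A" by blast
      then show "G k (map_prod (translate v) (translate v) z) = G k z" by (simp add: G_def indicator_def)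
    qed (use B in auto)
    then have "integral\<^sup>L ?N (\<lambda>z. indicator (A \<inter> B) z - P.prob A * indicator B z) = 0"
      by (simp add: G_def B(1)[symmetric] right_diff_distrib indicator_inter_arith mult.commute)
    then show ?thesis using iA[OF Bs] iA[OF sets.Int[OF A Bs]] by (simp add: sp)
  qed
  \<comment> \<open>The convergence lemma along a constant sequence serves as the Dynkin extension
    of \<open>indep\<close> from cylinders to \<open>A\<close>.\<close>
  have "(\<lambda>n::nat. P.prob (A \<inter> A)) \<longlonglongrightarrow> P.prob A * P.prob A"
  proof (rule P.tendsto_sigma_sets[where E = ?E and \<rho> = "\<lambda>n B. P.prob (A \<inter> B)"])
    show "Int_stable ?E"
    proof (rule Int_stableI)
      fix X Y assume "X \<in> ?E" "Y \<in> ?E"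
      then obtain S S' R R' where *: "X = containing2 S S'" "Y = containing2 R R'"
        "finite S" "finite S'" "finite R" "finite R'" by blast
      have "X \<inter> Y = containing2 (S \<union> R) (S' \<union> R')" unfolding * containing_Un by blast
      then show "X \<inter> Y \<in> ?E" using * by blast
    qed
    show "?E \<subseteq> Pow (space ?N)" by (simp add: sp)
    show "sets ?N = sigma_sets (space ?N) ?E" unfolding sp by (rule sets_pair_containing)
    have "UNIV = containing2 {} {}" by simp
    then show "space ?N \<in> ?E" unfolding sp by blast
    show "P.prob (A \<inter> B) \<le> P.prob B" if "B \<in> sets ?N" for B
      using that by (intro P.finite_measure_mono) auto
    show "P.prob (A \<inter> (B \<union> C)) = P.prob (A \<inter> B) + P.prob (A \<inter> C)"
      if "B \<in> sets ?N" "C \<in> sets ?N" "B \<inter> C = {}" for B C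
      unfolding Int_Un_distrib using that A by (intro P.finite_measure_Union) auto
    show "(\<lambda>n. P.prob (A \<inter> B)) \<longlonglongrightarrow> P.prob A * P.prob B" if "B \<in> ?E" for B
      using indep[OF that] by simp
  qed (use A in auto)
  then have "P.prob A = P.prob A * P.prob A" by (simp add: LIMSEQ_const_iff)
  then show ?thesis by simp
qed

text \<open>This is the gain from having proved ergodicity on the square: it is exactly the
  hypothesis that produces a mixing filter inside the hyperplane.\<close>

lemma hyperplane_mixing_filter:
  fixes a b :: 'd
  assumes "a \<noteq> b"
  shows "\<exists>F. F \<noteq> bot \<and> mixing_along \<mu> translate F \<and> (\<forall>\<^sub>F v in F. v \<in> {v. v $ a = 0})"
  using hyperplane_ergodic[OF assms] by (intro mixing_filter_exists) auto

end

section \<open>Independence\<close>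

context asl_process
begin

lemma prob_UNIV: "prob UNIV = 1"
  using prob_space by (simp only: space_process)

text \<open>The shears \<open>t \<mapsto> t + (t\<^sub>a - i) u\<close> with \<open>u\<^sub>a = 0\<close> fix level \<open>i\<close> and translate every other level
  along the hyperplane; removing level \<open>i\<close> in this way leaves pairs of translates of the remaining
  levels, where mixing along the hyperplane applies to the distinguished level.\<close>

lemma level_independent:
  fixes a b :: 'd
  assumes ab: "a \<noteq> b" and S1: "finite S1" "\<And>t. t \<in> S1 \<Longrightarrow> t $ a = i1"
    and S: "finite S" "\<And>t. t \<in> S \<Longrightarrow> t $ a \<noteq> i1"
  shows "prob (containing (S1 \<union> S)) = prob (containing S1) * prob (containing S)"
  using S1 S
proof (induction "card ((\<lambda>t. t $ a) ` S)" arbitrary: S1 S rule: less_induct)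
  case less
  note S1 = less.prems(1,2) and S = less.prems(3,4)
  show ?case
  proof (cases "S = {}")
    case True
    then show ?thesis by (simp add: prob_UNIV)
  next
    case False
    then obtain t0 where t0: "t0 \<in> S" by blast
    define i0 where "i0 = t0 $ a"
    \<comment> \<open>The shear fixing level \<open>i0\<close> displaces level \<open>i1\<close> by
      \<open>n *s u\<close>, so only multiples of \<open>n\<close> are available for mixing.\<close>
    define n where "n = i1 - i0"
    have n: "n \<noteq> 0" using S(2)[OF t0] by (simp add: n_def i0_def)
    define f where "f = {t\<in>S. t $ a = i0}"
    define r where "r = {t\<in>S. t $ a \<noteq> i0}"
    have fr: "S = f \<union> r" by (auto simp: f_def r_def)
    have fin: "finite f" "finite r" using S(1) by (auto simp: f_def r_def)
    define sh where "sh u = shear a i0 u" for u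
    define p where "p = prob (containing S1)"
    have p: "0 \<le> p" "p \<le> 1" by (auto simp: p_def)
    \<comment> \<open>Centring the distinguished level by \<open>p\<close> makes the correlation
      with the fixed level equal to the defect of independence.\<close>
    define h where "h u \<omega> = (indicator (containing (sh u ` S1)) \<omega> - p)
      * indicator (containing (sh u ` r)) \<omega>" for u and \<omega> :: "int ^ 'd \<Rightarrow> bool"
    note bi = bounded_measurable_indicator[OF containing_sets]
    have ii: "integrable \<mu> (indicator (containing X) :: _ \<Rightarrow> real)" if "finite X" for X
      using bi[OF that] by (rule integrable_bounded_measurable)
    have sh_a: "sh u t $ a = t $ a" if "u $ a = 0" for u t
      unfolding sh_def using that by (rule shear_coord)
    have sh_f: "sh u ` f = f" for u
      by (force simp: sh_def f_def shear_fixes image_iff)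
    have sh_S1: "containing (sh u ` S1) = translate (n *s u) -` containing S1" for u
    proof -
      have "sh u ` S1 = (\<lambda>t. t + n *s u) ` S1"
        by (intro image_cong) (auto simp: sh_def shear_def n_def S1(2))
      then show ?thesis by (simp add: translate_def relabel_vimage_containing)
    qed
    have "prob (containing (S1 \<union> S)) - p * prob (containing S) = 0"
    proof (rule asymptotically_orthogonal[where g = "indicator (containing f)" and h = h
          and C = 1 and I = "{u. u $ a = 0}"])
      show "bounded_measurable \<mu> (indicator (containing f))" using bi fin by simp
      show "h u \<in> borel_measurable \<mu>" for u
        unfolding h_def using bi[of "sh u ` S1"] bi[of "sh u ` r"] S1(1) fin
        by (intro bounded_measurable_measurable bounded_measurable_mult bounded_measurable_diff
            bounded_measurable_const) auto
      show "\<bar>h u \<omega>\<bar> \<le> 1" for u \<omega>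
        unfolding h_def using p by (auto simp: indicator_def)
      fix u :: "int ^ 'd" assume "u \<in> {u. u $ a = 0}"
      then have pres: "preserving (sh u)" unfolding sh_def by (intro preserving_shear) simp
      have ind: "indicator (containing (sh u ` X)) \<omega>
          = (indicator (containing X) (relabel (sh u) \<omega>) :: real)" for X \<omega>
        unfolding relabel_vimage_containing[symmetric] by (simp add: indicator_def)
      define k where "k \<omega> = indicator (containing f) \<omega>
        * ((indicator (containing S1) \<omega> - p) * indicator (containing r) \<omega>)" for \<omega> :: "int ^ 'd \<Rightarrow> bool"
      have k: "k \<omega> = indicator (containing (S1 \<union> S)) \<omega> - p * indicator (containing S) \<omega>" for \<omega>
        unfolding k_def fr containing_Un by (auto simp: indicator_def)
      have km: "k \<in> borel_measurable \<mu>"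
        using ii[of "S1 \<union> S"] ii[of S] S1 S unfolding k[abs_def] by simp
      have "expectation (\<lambda>\<omega>. indicator (containing f) \<omega> * h u \<omega>)
          = expectation (\<lambda>\<omega>. k (relabel (sh u) \<omega>))"
        unfolding h_def k_def ind[symmetric] sh_f ..
      also have "\<dots> = expectation k"
        using integral_distr[of "relabel (sh u)" \<mu> \<mu> k] km pres by (simp add: preserving_def)
      also have "\<dots> = prob (containing (S1 \<union> S)) - p * prob (containing S)"
        unfolding k[abs_def] using ii[of "S1 \<union> S"] ii[of S] S1 S by (simp add: space_process)
      finally show "expectation (\<lambda>\<omega>. indicator (containing f) \<omega> * h u \<omega>)
          = prob (containing (S1 \<union> S)) - p * prob (containing S)" .
    next
      fix J :: "(int ^ 'd) set" and e :: real
      assume J: "finite J" "J \<subseteq> {u. u $ a = 0}" and e: "0 < e"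
      obtain F where F: "F \<noteq> bot" "mixing_along \<mu> translate F" "\<forall>\<^sub>F v in F. \<forall>c\<in>{a}. v $ c = 0"
        using hyperplane_mixing_filter[OF ab] by auto
      obtain F' where F': "F' \<noteq> bot" "mixing_along \<mu> translate F'"
          "\<forall>\<^sub>F v in F'. \<exists>w. v = n *s w \<and> w $ a = 0"
        using mixing_along_multiples[OF mp_action_axioms F(1,2) n F(3)] by auto
      have "\<forall>\<^sub>F v in F'. \<bar>prob (containing (sh u ` S1) \<inter> translate v -` containing S1) - p\<^sup>2\<bar> < e" for u
      proof -
        have "((\<lambda>v. prob (containing (sh u ` S1) \<inter> translate v -` containing S1))
            \<longlongrightarrow> prob (containing (sh u ` S1)) * p) F'"
          using F'(2) S1(1) containing_sets unfolding mixing_along_def p_def by simp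
        moreover have "prob (containing (sh u ` S1)) = p"
          unfolding sh_S1 p_def using S1(1) containing_sets by (simp add: prob_vimage_T)
        ultimately show ?thesis
          by (auto dest!: tendstoD[OF _ e] simp: dist_real_def power2_eq_square)
      qed
      then have "\<forall>\<^sub>F v in F'. \<forall>u\<in>J. \<bar>prob (containing (sh u ` S1) \<inter> translate v -` containing S1) - p\<^sup>2\<bar> < e"
        using J by (simp add: eventually_ball_finite)
      from eventually_happens'[OF F'(1) eventually_conj[OF F'(3) this]]
      obtain w where w: "w $ a = 0" and small: "\<And>u. u \<in> J \<Longrightarrow>
          \<bar>prob (containing (sh u ` S1) \<inter> translate (n *s w) -` containing S1) - p\<^sup>2\<bar> < e"
        by blast
      have "\<bar>expectation (\<lambda>\<omega>. h u \<omega> * h w \<omega>)\<bar> \<le> e" if u: "u \<in> J" for u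
      proof -
        let ?R = "sh u ` r \<union> sh w ` r"
        have ua: "u $ a = 0" using u J by auto
        \<comment> \<open>Left open in \<open>X\<close>, because it is applied to the two sheared
          copies of \<open>S1\<close> together and to each one separately.\<close>
        have IH: "prob (containing (X \<union> ?R)) = prob (containing X) * prob (containing ?R)"
          if "finite X" "\<And>t. t \<in> X \<Longrightarrow> t $ a = i1" for X
        proof (rule less.hyps[OF _ that])
          have "card ((\<lambda>t. t $ a) ` ?R) \<le> card ((\<lambda>t. t $ a) ` S - {i0})"
            using S(1) by (intro card_mono) (auto simp: sh_a[OF ua] sh_a[OF w] r_def)
          also have "\<dots> < card ((\<lambda>t. t $ a) ` S)"
            using S(1) t0 unfolding i0_def by (intro card_Diff1_less) auto
          finally show "card ((\<lambda>t. t $ a) ` ?R) < card ((\<lambda>t. t $ a) ` S)" .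
        next
          fix t assume "t \<in> ?R"
          then obtain x where "x \<in> S" "t $ a = x $ a" by (auto simp: sh_a[OF ua] sh_a[OF w] r_def)
          then show "t $ a \<noteq> i1" using S(2) by simp
        qed (use fin in auto)
        have finX: "finite (sh u ` S1)" "finite (sh w ` S1)" "finite (sh u ` S1 \<union> sh w ` S1)" "finite ?R"
          using S1 fin by auto
        have p_sh: "prob (containing (sh v ` S1)) = p" for v
          unfolding sh_S1 p_def using S1(1) containing_sets by (simp add: prob_vimage_T)
        have "h u \<omega> * h w \<omega> = indicator (containing ((sh u ` S1 \<union> sh w ` S1) \<union> ?R)) \<omega>
            - p * indicator (containing (sh u ` S1 \<union> ?R)) \<omega>
            - p * indicator (containing (sh w ` S1 \<union> ?R)) \<omega>
            + p\<^sup>2 * indicator (containing ?R) \<omega>" for \<omega>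
          unfolding h_def containing_Un by (auto simp: indicator_def power2_eq_square algebra_simps)
        then have "expectation (\<lambda>\<omega>. h u \<omega> * h w \<omega>)
          = prob (containing ((sh u ` S1 \<union> sh w ` S1) \<union> ?R))
            - p * prob (containing (sh u ` S1 \<union> ?R)) - p * prob (containing (sh w ` S1 \<union> ?R))
            + p\<^sup>2 * prob (containing ?R)"
          using ii[of "(sh u ` S1 \<union> sh w ` S1) \<union> ?R"] ii[of "sh u ` S1 \<union> ?R"]
            ii[of "sh w ` S1 \<union> ?R"] ii[of ?R] finX by (simp add: space_process)
        \<comment> \<open>Factoring the four terms leaves the covariance of two translates of the
          distinguished level, which the choice of \<open>w\<close> made small.\<close>
        also have "\<dots> = (prob (containing (sh u ` S1 \<union> sh w ` S1)) - p\<^sup>2) * prob (containing ?R)"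
        proof -
          have "prob (containing ((sh u ` S1 \<union> sh w ` S1) \<union> ?R))
              = prob (containing (sh u ` S1 \<union> sh w ` S1)) * prob (containing ?R)"
            using S1 by (intro IH) (auto simp: sh_a[OF ua] sh_a[OF w])
          moreover have "prob (containing (sh u ` S1 \<union> ?R)) = p * prob (containing ?R)"
            using S1 p_sh[of u] by (subst IH) (auto simp: sh_a[OF ua])
          moreover have "prob (containing (sh w ` S1 \<union> ?R)) = p * prob (containing ?R)"
            using S1 p_sh[of w] by (subst IH) (auto simp: sh_a[OF w])
          ultimately show ?thesis by (simp add: power2_eq_square algebra_simps)
        qed
        finally have "\<bar>expectation (\<lambda>\<omega>. h u \<omega> * h w \<omega>)\<bar>
            = \<bar>prob (containing (sh u ` S1 \<union> sh w ` S1)) - p\<^sup>2\<bar> * prob (containing ?R)"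
          by (simp add: abs_mult)
        also have "\<dots> \<le> e * 1"
          using small[OF u] unfolding containing_Un sh_S1[of w] by (intro mult_mono) auto
        finally show ?thesis by simp
      qed
      then show "\<exists>w\<in>{u. u $ a = 0}. \<forall>u\<in>J. \<bar>expectation (\<lambda>\<omega>. h u \<omega> * h w \<omega>)\<bar> \<le> e"
        using w by blast
    qed
    then show ?thesis by (simp add: p_def)
  qed
qed

text \<open>Two distinct sites differ in some coordinate \<open>a\<close>. Splitting
  \<open>S\<close> by the value \<open>s $ a\<close> leaves two smaller nonempty sets, independent
  of each other by level independence; a second coordinate \<open>b\<close> exists because the
  dimension is at least 2.\<close>

lemma prob_containing:
  assumes "CARD('d) \<ge> 2" "finite S"
  shows "prob (containing S) = prob (containing {0}) ^ card S"
  using assms(2)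
proof (induction "card S" arbitrary: S rule: less_induct)
  case less
  consider "S = {}" | t where "S = {t}" | s t where "s \<in> S" "t \<in> S" "s \<noteq> t" by blast
  then show ?case
  proof cases
    case 1
    then show ?thesis by (simp add: prob_UNIV)
  next
    case (2 t)
    have "translate t -` containing {0} = containing {t}"
      by (simp add: translate_def relabel_vimage_containing)
    then show ?thesis
      using prob_vimage_T[of "containing {0}" t] containing_sets 2 by simp
  next
    case (3 s t)
    then obtain a where a: "s $ a \<noteq> t $ a" by (auto simp: vec_eq_iff)
    have "(UNIV :: 'd set) \<noteq> {a}"
    proof
      assume "(UNIV :: 'd set) = {a}"
      then have "CARD('d) = card {a}" by (rule arg_cong)
      then show False using assms(1) by simp
    qed
    then obtain b where b: "a \<noteq> b" using UNIV_eq_I by (metis singleton_iff)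
    define S1 where "S1 = {x\<in>S. x $ a = s $ a}"
    define S2 where "S2 = {x\<in>S. x $ a \<noteq> s $ a}"
    have S: "S = S1 \<union> S2" "S1 \<inter> S2 = {}" "finite S1" "finite S2" "s \<in> S1" "t \<in> S2"
      using less.prems 3 a by (auto simp: S1_def S2_def)
    have card: "card S = card S1 + card S2" unfolding S(1) using S by (intro card_Un_disjoint) auto
    moreover have "card S1 > 0" "card S2 > 0" using S by (auto simp: card_gt_0_iff)
    ultimately have "prob (containing S1) = prob (containing {0}) ^ card S1"
        "prob (containing S2) = prob (containing {0}) ^ card S2"
      using S by (auto intro!: less.hyps)
    moreover have "prob (containing (S1 \<union> S2)) = prob (containing S1) * prob (containing S2)"
      using S by (intro level_independent[OF b]) (auto simp: S1_def S2_def)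
    ultimately show ?thesis using S(1) card by (simp add: power_add)
  qed
qed

end

section \<open>Identification with the product measure\<close>

theorem corollary1p3:
  fixes \<mu> :: "(int ^ 'd \<Rightarrow> bool) measure"
  assumes "CARD('d) \<ge> 3"
    and "prob_space \<mu>"
    and "sets \<mu> = sets borel"
    and "invariant_measure ASL subset_action \<mu>"
    and "weakly_mixing_action translation_group subset_action \<mu>"
  shows "\<exists>p::real. 0 \<le> p \<and> p \<le> 1 \<and>
    \<mu> = PiM (UNIV :: (int ^ 'd) set) (\<lambda>_. measure_pmf (bernoulli_pmf (1 - p)))"
proof -
  interpret asl_process \<mu>
    using assms(2-) by (simp add: asl_process_def asl_process_axioms_def)
  define q where "q = prob (containing {0})"
  have q: "0 \<le> q" "q \<le> 1" by (auto simp: q_def)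
  let ?B = "measure_pmf (bernoulli_pmf q)"
  let ?P = "PiM (UNIV :: (int ^ 'd) set) (\<lambda>_. ?B)"
  interpret B: product_prob_space "\<lambda>_ :: int ^ 'd. ?B" UNIV
    by unfold_locales
  let ?E = "{containing S | S :: (int ^ 'd) set. finite S}"
  have "\<mu> = ?P"
  proof (rule measure_eqI_generator_eq[where E = ?E and \<Omega> = UNIV and A = "\<lambda>_ :: nat. UNIV"])
    show "Int_stable ?E"
    proof (rule Int_stableI)
      fix X Y assume "X \<in> ?E" "Y \<in> ?E"
      then obtain S R where "X = containing S" "Y = containing R" "finite S" "finite R" by blast
      then have "X \<inter> Y = containing (S \<union> R)" "finite (S \<union> R)" by (auto simp: containing_Un)
      then show "X \<inter> Y \<in> ?E" by blast
    qed
    show "sets \<mu> = sigma_sets UNIV ?E" by (simp add: sets_borel sets_containing)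
    have "sets ?P = sets (PiM (UNIV :: (int ^ 'd) set) (\<lambda>_. count_space UNIV :: bool measure))"
      by (intro sets_PiM_cong) auto
    then show "sets ?P = sigma_sets UNIV ?E"
      by (simp add: sets_borel_fun_bool[symmetric] sets_containing)
    have "UNIV = containing {}" by simp
    then show "range (\<lambda>_ :: nat. UNIV) \<subseteq> ?E" by blast
    show "emeasure \<mu> UNIV \<noteq> \<infinity>" by (simp add: emeasure_eq_measure)
    fix X assume "X \<in> ?E"
    then obtain S where X: "X = containing S" "finite S" by blast
    have "emeasure \<mu> X = ennreal (q ^ card S)"
      using prob_containing[of S] assms(1) X by (simp add: emeasure_eq_measure q_def)
    also have "\<dots> = (\<Prod>t\<in>S. emeasure ?B {True})"
      using q by (simp add: emeasure_pmf_single ennreal_power)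
    also have "\<dots> = emeasure ?P {\<omega> \<in> space ?P. \<forall>t\<in>S. \<omega> t \<in> {True}}"
      using X by (intro B.emeasure_PiM_Collect[symmetric]) auto
    also have "{\<omega> \<in> space ?P. \<forall>t\<in>S. \<omega> t \<in> {True}} = X"
      by (auto simp: X containing_def space_PiM)
    finally show "emeasure \<mu> X = emeasure ?P X" .
  qed auto
  then have "\<mu> = PiM (UNIV :: (int ^ 'd) set) (\<lambda>_. measure_pmf (bernoulli_pmf (1 - (1 - q))))"
    by simp
  \<comment> \<open>\<open>q\<close> is the probability that a site is occupied, whereas the
    parameter sought is the weight of the value 0.\<close>
  then show ?thesis using q by (intro exI[of _ "1 - q"]) auto
qed

end
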